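(* If $\alpha$ is of the form $\sigma_{\beta}$ for some ordinal $\beta$, then there are no $\alpha$-wITRM-recognizable constructible subsets of $\alpha$ (and thus, in particular, no constructible subset of $\alpha$ that is $\alpha$-wITRM-recognizable but not $\alpha$-wITRM-computable, i.e., no lost melodies for $\alpha$-wITRMs).
   Context: For an ordinal $\beta$, $\sigma_{\beta}$ is the smallest ordinal $\gamma>\beta$ such that $L_{\gamma}\prec_{\Sigma_{1}}L$. Machines. An $\alpha$-register machine program is an ordinary register machine program: a finite list of numbered lines using finitely many registers, each register containing an ordinal $<\alpha$. Commands: increment a register by $1$; copy one register to another; jump to a given line if two register contents agree (otherwise go to the next line); oracle command: for an oracle $x\subseteq\alpha$, replace the content $\iota$ of register $j$ by $1$ if $\iota\in x$ and by $0$ otherwise. Computations run along the ordinals: at successor times the active command is carried out; at limit times the index of the active program line and each register content are the inferior limits of the sequences of their earlier values. If such an inferior limit of register contents equals $\alpha$ (overflow), the computation of an $\alpha$-wITRM is undefined. Inputs and parameters are written in the first registers, all other registers start with $0$. $P^{x}(\vec\xi)\downarrow=c$ means that $P$ with oracle $x$ and input $\vec\xi$ halts with $c$ in the output register. A set $x\subseteq\alpha$ is $\alpha$-wITRM-computable if there are an $\alpha$-wITRM-program $P$ and a parameter $\rho<\alpha$ such that $P(\iota,\rho)\downarrow=\chi_{x}(\iota)$ for all $\iota<\alpha$. It is $\alpha$-wITRM-recognizable if there are an $\alpha$-wITRM-program $P$ and a parameter $\xi<\alpha$ such that, for all $y\subseteq\alpha$, $P^{y}(\xi)$ is defined and halts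 with output $1$ if $y=x$ and with output $0$ if $y\neq x$. Only constructible subsets of $\alpha$ are considered. *)

theory Defs
  imports Main
begin

section \<open>The set-theoretic universe\<close>

text \<open>
  A type of class \<open>zf\<close> plays the role of the universe of sets, \<open>elts x\<close> being the extension of the
  set \<open>x\<close>; HOL sets of type \<open>'v set\<close> play the role of classes. The schemes of
  Zermelo-Fraenkel set theory are stated for arbitrary classes and class functions. Every set of
  pairwise disjoint nonempty sets then has a choice set, by applying \<open>replacement\<close> to a Hilbert
  choice function, so that the axiom of choice need not be listed.
\<close>

class zf =
  fixes elts :: "'a \<Rightarrow> 'a set"
  assumes extensionality: "elts x = elts y \<Longrightarrow> x = y"
    and foundation: "wf {(x, y). x \<in> elts y}"
    and pairing: "\<exists>z. elts z = {x, y}"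
    and union: "\<exists>z. elts z = (\<Union>y\<in>elts x. elts y)"
    and power_set: "\<exists>z. elts z = {y. elts y \<subseteq> elts x}"
    and infinity: "\<exists>w. (\<exists>e\<in>elts w. elts e = {}) \<and>
                        (\<forall>y\<in>elts w. \<exists>z\<in>elts w. elts z = insert y (elts y))"
    and separation: "\<exists>z. elts z = {y \<in> elts x. \<phi> y}"
    and replacement: "\<exists>z. elts z = F ` elts x"

text \<open>The set with a given extension; meaningful only for classes that are sets.\<close>

definition set_of :: "'v::zf set \<Rightarrow> 'v" where
  "set_of A = (THE x. elts x = A)"

lemma set_of_elts [simp]: "set_of (elts x) = x"
  unfolding set_of_def by (rule the_equality) (auto intro: extensionality)

section \<open>Von Neumann ordinals\<close>

text \<open>For ordinals, \<open>\<gamma> < \<delta>\<close> is \<open>\<gamma> \<in> elts \<delta>\<close> and \<open>\<gamma> \<le> \<delta>\<close> is \<open>elts \<gamma> \<subseteq> elts \<delta>\<close>.\<close>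

definition zero :: "'v::zf" where
  "zero = set_of {}"

definition succ :: "'v::zf \<Rightarrow> 'v" where
  "succ x = set_of (insert x (elts x))"

definition transitive :: "'v::zf \<Rightarrow> bool" where
  "transitive x \<longleftrightarrow> (\<forall>y\<in>elts x. elts y \<subseteq> elts x)"

definition Ord :: "'v::zf \<Rightarrow> bool" where
  "Ord x \<longleftrightarrow> transitive x \<and> (\<forall>y\<in>elts x. transitive y)"

definition Limit :: "'v::zf \<Rightarrow> bool" where
  "Limit \<mu> \<longleftrightarrow> Ord \<mu> \<and> \<mu> \<noteq> zero \<and> (\<forall>\<tau>\<in>elts \<mu>. succ \<tau> \<in> elts \<mu>)"

lemma elts_zero [simp]: "elts (zero :: 'v::zf) = {}"
proof -
  obtain z :: 'v where "elts z = {y \<in> elts undefined. False}"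
    using separation[of undefined "\<lambda>_. False"] by blast
  then have z: "elts z = {}" by simp
  then show ?thesis unfolding zero_def using set_of_elts[of z] by simp
qed

lemma elts_succ [simp]: "elts (succ (x :: 'v::zf)) = insert x (elts x)"
proof -
  obtain s :: 'v where s: "elts s = {x, x}" using pairing by blast
  obtain p :: 'v where p: "elts p = {x, s}" using pairing by blast
  obtain u :: 'v where "elts u = (\<Union>y\<in>elts p. elts y)" using union by blast
  then have "elts u = insert x (elts x)" using s p by auto
  then show ?thesis unfolding succ_def using set_of_elts[of u] by simp
qed

lemma mem_irrefl: "(x :: 'v::zf) \<notin> elts x"
  using wf_not_refl[OF foundation, of x] by simp

lemma mem_asym: "(x :: 'v::zf) \<in> elts y \<Longrightarrow> y \<notin> elts x"
  using wf_not_sym[OF foundation, of x y] by simp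

lemma succ_inject [simp]: "succ (x :: 'v::zf) = succ y \<longleftrightarrow> x = y"
proof
  assume "succ x = succ y"
  then have "insert x (elts x) = insert y (elts y)" by (metis elts_succ)
  then show "x = y" using mem_asym[of x y] by (metis insert_iff)
qed simp

section \<open>Formulas of set theory\<close>

datatype fm =
    Mem nat nat
  | Equal nat nat
  | Neg fm
  | Conj fm fm
  | Exists nat fm

primrec fv :: "fm \<Rightarrow> nat set" where
  "fv (Mem i j) = {i, j}"
| "fv (Equal i j) = {i, j}"
| "fv (Neg \<phi>) = fv \<phi>"
| "fv (Conj \<phi> \<psi>) = fv \<phi> \<union> fv \<psi>"
| "fv (Exists i \<phi>) = fv \<phi> - {i}"

text \<open>\<open>sat M s \<phi>\<close>: the structure with domain \<open>M\<close> and the true membership relation satisfies \<open>\<phi>\<close>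
  under the assignment \<open>s\<close>. The domain may be a proper class.\<close>

primrec sat :: "'v::zf set \<Rightarrow> (nat \<Rightarrow> 'v) \<Rightarrow> fm \<Rightarrow> bool" where
  "sat M s (Mem i j) \<longleftrightarrow> s i \<in> elts (s j)"
| "sat M s (Equal i j) \<longleftrightarrow> s i = s j"
| "sat M s (Neg \<phi>) \<longleftrightarrow> \<not> sat M s \<phi>"
| "sat M s (Conj \<phi> \<psi>) \<longleftrightarrow> sat M s \<phi> \<and> sat M s \<psi>"
| "sat M s (Exists i \<phi>) \<longleftrightarrow> (\<exists>a\<in>M. sat M (s(i := a)) \<phi>)"

inductive Delta0 :: "fm \<Rightarrow> bool" where
  "Delta0 (Mem i j)"
| "Delta0 (Equal i j)"
| "Delta0 \<phi> \<Longrightarrow> Delta0 (Neg \<phi>)"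
| "Delta0 \<phi> \<Longrightarrow> Delta0 \<psi> \<Longrightarrow> Delta0 (Conj \<phi> \<psi>)"
| "Delta0 \<phi> \<Longrightarrow> i \<noteq> j \<Longrightarrow> Delta0 (Exists i (Conj (Mem i j) \<phi>))"

inductive Sigma1 :: "fm \<Rightarrow> bool" where
  "Delta0 \<phi> \<Longrightarrow> Sigma1 \<phi>"
| "Sigma1 \<phi> \<Longrightarrow> Sigma1 (Exists i \<phi>)"

definition Sigma1_elementary :: "'v::zf set \<Rightarrow> 'v set \<Rightarrow> bool" where
  "Sigma1_elementary M N \<longleftrightarrow>
     M \<subseteq> N \<and> (\<forall>\<phi> s. Sigma1 \<phi> \<longrightarrow> s ` fv \<phi> \<subseteq> M \<longrightarrow> (sat M s \<phi> \<longleftrightarrow> sat N s \<phi>))"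

section \<open>The constructible hierarchy\<close>

text \<open>The set of subsets of \<open>A\<close> that are first-order definable over \<open>A\<close> with parameters. Variable 0
  is the defined one. Only the values of the other free variables are required to lie in \<open>A\<close>, since
  no assignment has all its values in the empty set.\<close>

definition Def :: "'v::zf \<Rightarrow> 'v" where
  "Def A = set_of {set_of {a \<in> elts A. sat (elts A) (s(0 := a)) \<phi>} | \<phi> s.
                     s ` (fv \<phi> - {0}) \<subseteq> elts A}"

text \<open>The last branch covers zero and limits.\<close>

function Lset :: "'v::zf \<Rightarrow> 'v" where
  "Lset \<gamma> = (if \<exists>\<delta>. \<gamma> = succ \<delta> then Def (Lset (THE \<delta>. \<gamma> = succ \<delta>))
              else set_of (\<Union>\<delta>\<in>elts \<gamma>. elts (Lset \<delta>)))"
  by auto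
termination
  by (relation "{(x, y). x \<in> elts y}") (auto simp: foundation)

declare Lset.simps [simp del]

lemma Lset_zero: "Lset (zero :: 'v::zf) = zero"
proof -
  have "\<nexists>\<delta>. (zero :: 'v) = succ \<delta>" by (metis elts_succ elts_zero insert_not_empty)
  then show ?thesis by (subst Lset.simps) (simp flip: zero_def)
qed

lemma Lset_succ: "Lset (succ \<gamma>) = Def (Lset (\<gamma> :: 'v::zf))"
  by (subst Lset.simps) auto

lemma Lset_Limit:
  assumes "Limit (\<mu> :: 'v::zf)"
  shows "Lset \<mu> = set_of (\<Union>\<delta>\<in>elts \<mu>. elts (Lset \<delta>))"
proof -
  have "\<mu> \<noteq> succ \<delta>" for \<delta>
  proof
    assume "\<mu> = succ \<delta>"
    then have "\<delta> \<in> elts \<mu>" by simp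
    then have "succ \<delta> \<in> elts \<mu>" using assms unfolding Limit_def by blast
    with \<open>\<mu> = succ \<delta>\<close> show False using mem_irrefl by blast
  qed
  then show ?thesis by (subst Lset.simps) auto
qed

definition constructible :: "'v::zf set" where
  "constructible = (\<Union>\<gamma>\<in>{\<gamma>. Ord \<gamma>}. elts (Lset \<gamma>))"

text \<open>\<open>is_sigma \<beta> \<gamma>\<close>: \<open>\<gamma>\<close> is the ordinal \<open>\<sigma>\<^sub>\<beta>\<close>.\<close>

definition is_sigma :: "'v::zf \<Rightarrow> 'v \<Rightarrow> bool" where
  "is_sigma \<beta> \<gamma> \<longleftrightarrow>
     Ord \<gamma> \<and> \<beta> \<in> elts \<gamma> \<and> Sigma1_elementary (elts (Lset \<gamma>)) constructible \<and>
     (\<forall>\<delta>. Ord \<delta> \<and> \<beta> \<in> elts \<delta> \<and> Sigma1_elementary (elts (Lset \<delta>)) constructible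
           \<longrightarrow> elts \<gamma> \<subseteq> elts \<delta>)"

section \<open>Infinite time register machines\<close>

text \<open>\<open>Copy i j\<close> overwrites register \<open>j\<close> with the content of register \<open>i\<close>; \<open>Jump i j k\<close> goes to line
  \<open>k\<close> if registers \<open>i\<close> and \<open>j\<close> agree. Lines and registers are numbered from 0. All registers that
  do not occur in a program keep their initial content.\<close>

datatype instr = Inc nat | Copy nat nat | Jump nat nat nat | Oracle nat

type_synonym prog = "instr list"

text \<open>A configuration consists of the index of the active line and the register contents.\<close>

type_synonym 'v config = "nat \<times> (nat \<Rightarrow> 'v)"

fun step :: "prog \<Rightarrow> 'v::zf \<Rightarrow> 'v config \<Rightarrow> 'v config" where
  "step P x (l, R) = (case P ! l of
       Inc i \<Rightarrow> (Suc l, R(i := succ (R i)))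
     | Copy i j \<Rightarrow> (Suc l, R(j := R i))
     | Jump i j k \<Rightarrow> (if R i = R j then k else Suc l, R)
     | Oracle i \<Rightarrow> (Suc l, R(i := if R i \<in> elts x then succ zero else zero)))"

definition initial :: "'v::zf list \<Rightarrow> 'v config" where
  "initial ins = (0, \<lambda>i. if i < length ins then ins ! i else zero)"

text \<open>The inferior limit at \<open>\<mu>\<close> is the supremum over \<open>\<sigma> < \<mu>\<close> of the infimum over \<open>\<sigma> \<le> \<tau> < \<mu>\<close>. For
  von Neumann ordinals, supremum and infimum are union and intersection. The line indices before a
  limit time are bounded by the length of the program, so \<open>SUP\<close> on \<open>nat\<close> is a proper supremum.\<close>

definition ord_liminf :: "'v::zf \<Rightarrow> ('v \<Rightarrow> 'v) \<Rightarrow> 'v" where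
  "ord_liminf \<mu> f =
     set_of (\<Union>\<sigma>\<in>elts \<mu>. \<Inter>\<tau>\<in>{\<tau> \<in> elts \<mu>. elts \<sigma> \<subseteq> elts \<tau>}. elts (f \<tau>))"

definition nat_liminf :: "'v::zf \<Rightarrow> ('v \<Rightarrow> nat) \<Rightarrow> nat" where
  "nat_liminf \<mu> f = (SUP \<sigma>\<in>elts \<mu>. INF \<tau>\<in>{\<tau> \<in> elts \<mu>. elts \<sigma> \<subseteq> elts \<tau>}. f \<tau>)"

text \<open>\<open>computation \<alpha> P x ins \<theta> c\<close>: up to and including time \<open>\<theta>\<close>, \<open>c\<close> is the computation of \<open>P\<close> with
  oracle \<open>x\<close> on the inputs \<open>ins\<close>. It has not halted before \<open>\<theta>\<close>, and no register has overflowed.\<close>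

definition computation ::
    "'v::zf \<Rightarrow> prog \<Rightarrow> 'v \<Rightarrow> 'v list \<Rightarrow> 'v \<Rightarrow> ('v \<Rightarrow> 'v config) \<Rightarrow> bool" where
  "computation \<alpha> P x ins \<theta> c \<longleftrightarrow>
     Ord \<theta> \<and>
     c zero = initial ins \<and>
     (\<forall>\<tau>\<in>elts \<theta>. fst (c \<tau>) < length P \<and> c (succ \<tau>) = step P x (c \<tau>)) \<and>
     (\<forall>\<mu>\<in>elts (succ \<theta>). Limit \<mu> \<longrightarrow>
        c \<mu> = (nat_liminf \<mu> (\<lambda>\<tau>. fst (c \<tau>)), \<lambda>i. ord_liminf \<mu> (\<lambda>\<tau>. snd (c \<tau>) i))) \<and>
     (\<forall>\<tau>\<in>elts (succ \<theta>). \<forall>i. snd (c \<tau>) i \<in> elts \<alpha>)"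

text \<open>A computation halts when the active line is not a line of the program. The output register is
  the first one.\<close>

definition halts_with :: "'v::zf \<Rightarrow> prog \<Rightarrow> 'v \<Rightarrow> 'v list \<Rightarrow> 'v \<Rightarrow> bool" where
  "halts_with \<alpha> P x ins v \<longleftrightarrow>
     (\<exists>\<theta> c. computation \<alpha> P x ins \<theta> c \<and> length P \<le> fst (c \<theta>) \<and> snd (c \<theta>) 0 = v)"

text \<open>A computation without oracle is one with the empty oracle.\<close>

definition wITRM_computable :: "'v::zf \<Rightarrow> 'v \<Rightarrow> bool" where
  "wITRM_computable \<alpha> x \<longleftrightarrow>
     (\<exists>P. \<exists>\<rho>\<in>elts \<alpha>. \<forall>\<iota>\<in>elts \<alpha>.
        halts_with \<alpha> P zero [\<iota>, \<rho>] (if \<iota> \<in> elts x then succ zero else zero))"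

text \<open>The class \<open>K\<close> collects the sets that are admitted as oracles. For \<open>K = UNIV\<close> the program has to
  decide, for every subset \<open>y\<close> of \<open>\<alpha>\<close>, whether \<open>y = x\<close>; for \<open>K = constructible\<close> it has to do so
  for the constructible subsets only.\<close>

definition wITRM_recognizable :: "'v::zf set \<Rightarrow> 'v \<Rightarrow> 'v \<Rightarrow> bool" where
  "wITRM_recognizable K \<alpha> x \<longleftrightarrow>
     (\<exists>P. \<exists>\<xi>\<in>elts \<alpha>. \<forall>y\<in>K. elts y \<subseteq> elts \<alpha> \<longrightarrow>
        halts_with \<alpha> P y [\<xi>] (if y = x then succ zero else zero))"

definition lost_melody :: "'v::zf set \<Rightarrow> 'v \<Rightarrow> 'v \<Rightarrow> bool" where
  "lost_melody K \<alpha> x \<longleftrightarrow>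
     x \<in> constructible \<and> elts x \<subseteq> elts \<alpha> \<and>
     wITRM_recognizable K \<alpha> x \<and> \<not> wITRM_computable \<alpha> x"

end

theory Submission
  imports Defs
begin

text \<open>
  Suppose that \<open>P\<close> with parameter \<open>\<xi>\<close> recognizes a constructible \<open>x \<subseteq> \<alpha>\<close>. The computation accepting
  \<open>x\<close> is constructible, so \<open>L\<close> satisfies the \<open>\<Sigma>\<^sub>1\<close> statement in \<open>\<xi>\<close> that there are an ordinal \<open>b\<close>, an
  oracle \<open>y\<close> and a computation of \<open>P\<close> with this oracle, input \<open>\<xi>\<close> and all register contents below \<open>b\<close>
  that halts with output 1. By elementarity there are such \<open>b\<close>, \<open>y\<close> and computation in \<open>L\<^sub>\<alpha>\<close>; in
  particular \<open>b < \<alpha>\<close>. This computation queries the oracle below \<open>b\<close> only, so that \<open>P\<close> accepts both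
  \<open>y \<inter> b\<close> and \<open>(y \<inter> b) \<union> {b}\<close>, which cannot both be equal to \<open>x\<close>.

  For the constructibility of computations only bounded separation in \<open>L\<close> and the fact that every set
  of constructible sets is included in some \<open>L\<^sub>\<gamma>\<close> are used: at a limit time \<open>\<mu>\<close>, the graph of the
  computation up to \<open>\<mu>\<close> is defined over a level containing all shorter computations.
\<close>

section \<open>Sets and ordinals\<close>

lemma mem_induct [case_names mem]:
  "(\<And>x. (\<And>y. y \<in> elts x \<Longrightarrow> Q y) \<Longrightarrow> Q x) \<Longrightarrow> Q (a :: 'v::zf)"
  by (rule wf_induct_rule[OF foundation]) auto

lemma elts_eq_iff: "x = y \<longleftrightarrow> elts x = elts (y :: 'v::zf)"
  using extensionality by blast

text \<open>By separation a class included in a set is a set, so that the description in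
  \<open>set_of\<close> denotes it.\<close>

lemma elts_set_of:
  assumes "A \<subseteq> elts (x :: 'v::zf)"
  shows "elts (set_of A) = A"
proof -
  obtain z :: 'v where "elts z = {y \<in> elts x. y \<in> A}"
    using separation[of x "\<lambda>y. y \<in> A"] by blast
  then have "elts z = A" using assms by auto
  then show ?thesis using set_of_elts[of z] by simp
qed

lemma elts_image [simp]: "elts (set_of (F ` elts (x :: 'v::zf))) = (F ` elts x :: 'v set)"
  using replacement[of F x] set_of_elts by metis

lemma elts_UN [simp]:
  "elts (set_of (\<Union>y\<in>elts (x :: 'v::zf). elts (F y :: 'v))) = (\<Union>y\<in>elts x. elts (F y))"
proof -
  obtain z :: 'v where z: "elts z = F ` elts x" using replacement by blast
  obtain u :: 'v where "elts u = (\<Union>y\<in>elts z. elts y)" using union by blast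
  then have "elts u = (\<Union>y\<in>elts x. elts (F y))" using z by simp
  then show ?thesis using set_of_elts[of u] by metis
qed

lemma elts_upair [simp]: "elts (set_of {x, y :: 'v::zf}) = {x, y}"
  using pairing[of x y] set_of_elts by metis

lemma elts_single [simp]: "elts (set_of {x :: 'v::zf}) = {x}"
  using elts_upair[of x x] by simp

lemma elts_union2 [simp]: "elts (set_of (elts x \<union> elts y)) = elts x \<union> elts (y :: 'v::zf)"
  using elts_UN[of "\<lambda>z. z" "set_of {x, y}"] by simp

lemma elts_insert [simp]: "elts (set_of (insert y (elts x))) = insert y (elts (x :: 'v::zf))"
  using elts_union2[of "set_of {y}" x] by simp

lemma finite_is_set: "finite A \<Longrightarrow> \<exists>x :: 'v::zf. elts x = A"
proof (induction rule: finite_induct)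
  case empty
  show ?case using elts_zero by blast
next
  case (insert a A)
  then show ?case using elts_insert by metis
qed

text \<open>Kuratowski's pair, which has a bounded definition (\<open>D0_is_opair\<close>).\<close>

definition opair :: "'v::zf \<Rightarrow> 'v \<Rightarrow> 'v" where
  "opair a b = set_of {set_of {a}, set_of {a, b}}"

lemma elts_opair: "elts (opair a b) = {set_of {a}, set_of {a, b}}"
  by (simp add: opair_def)

lemma opair_inject [simp]: "opair a b = opair c d \<longleftrightarrow> a = c \<and> b = (d :: 'v::zf)"
  by (auto simp: elts_eq_iff[of "opair a b"] elts_opair doubleton_eq_iff elts_eq_iff[of "set_of _"])

section \<open>Elementary theory of ordinals\<close>

lemma Ord_in_Ord: "Ord x \<Longrightarrow> y \<in> elts x \<Longrightarrow> Ord (y :: 'v::zf)"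
  unfolding Ord_def transitive_def by blast

lemma Ord_trans: "Ord x \<Longrightarrow> y \<in> elts x \<Longrightarrow> z \<in> elts y \<Longrightarrow> z \<in> elts (x :: 'v::zf)"
  unfolding Ord_def transitive_def by blast

lemma OrdI: "(\<And>y. y \<in> elts x \<Longrightarrow> Ord y \<and> elts y \<subseteq> elts x) \<Longrightarrow> Ord (x :: 'v::zf)"
  unfolding Ord_def transitive_def by blast

lemma Ord_zero [simp]: "Ord (zero :: 'v::zf)"
  by (rule OrdI) simp

lemma Ord_succ [simp]: "Ord (succ x) \<longleftrightarrow> Ord (x :: 'v::zf)"
proof
  assume "Ord (succ x)"
  then show "Ord x" by (rule Ord_in_Ord) simp
next
  assume x: "Ord x"
  show "Ord (succ x)"
  proof (rule OrdI)
    fix y assume "y \<in> elts (succ x)"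
    then have "y = x \<or> y \<in> elts x" by simp
    then have "Ord y \<and> elts y \<subseteq> elts x" using x Ord_in_Ord Ord_trans by blast
    then show "Ord y \<and> elts y \<subseteq> elts (succ x)" by auto
  qed
qed

lemma Ord_UN:
  fixes x :: "'v::zf" and F :: "'v \<Rightarrow> 'v"
  assumes "\<And>y. y \<in> elts x \<Longrightarrow> Ord (F y)"
  shows "Ord (set_of (\<Union>y\<in>elts x. elts (F y)))"
proof (rule OrdI)
  fix y assume "y \<in> elts (set_of (\<Union>y\<in>elts x. elts (F y)))"
  then obtain z where z: "z \<in> elts x" "y \<in> elts (F z)" by auto
  then have "Ord y" "elts y \<subseteq> elts (F z)"
    using assms Ord_in_Ord[of "F z"] Ord_trans[of "F z"] by blast+
  then show "Ord y \<and> elts y \<subseteq> elts (set_of (\<Union>y\<in>elts x. elts (F y)))"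
    using z(1) by auto
qed

text \<open>Nested membership induction on both ordinals: if they were incomparable, the induction
  hypotheses would place the elements of each in the other, against extensionality.\<close>

lemma Ord_linear:
  "Ord x \<Longrightarrow> Ord y \<Longrightarrow> x \<in> elts y \<or> x = y \<or> y \<in> elts (x :: 'v::zf)"
proof (induction x arbitrary: y rule: mem_induct)
  case (mem x)
  note IHx = mem.IH and x = mem.prems(1)
  show ?case using mem.prems(2)
  proof (induction y rule: mem_induct)
    case (mem y)
    show ?case
    proof (rule ccontr)
      assume neg: "\<not> ?thesis"
      have "elts x \<subseteq> elts y"
        using IHx Ord_in_Ord[OF x] Ord_trans[OF x] mem.prems neg by blast
      moreover have "elts y \<subseteq> elts x"
        using mem.IH Ord_in_Ord[OF mem.prems] Ord_trans[OF mem.prems] neg by blast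
      ultimately show False using neg extensionality by blast
    qed
  qed
qed

lemma Ord_subset_iff:
  "Ord x \<Longrightarrow> Ord y \<Longrightarrow> elts x \<subseteq> elts y \<longleftrightarrow> x \<in> elts (succ (y :: 'v::zf))"
  unfolding elts_succ insert_iff using Ord_linear[of x y] Ord_trans[of y x] mem_irrefl[of y] by blast

lemma zero_in_Ord: "Ord x \<Longrightarrow> y \<in> elts x \<Longrightarrow> zero \<in> elts (x :: 'v::zf)"
  using Ord_linear[OF _ Ord_zero, of x] by (metis elts_zero empty_iff)

lemma Ord_cases:
  assumes "Ord (x :: 'v::zf)"
  obtains "x = zero" | y where "Ord y" "x = succ y" | "Limit x"
proof -
  have "Limit x" if "x \<noteq> zero" and ns: "\<nexists>y. Ord y \<and> x = succ y"
    unfolding Limit_def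
  proof (intro conjI ballI assms that(1))
    fix y assume y: "y \<in> elts x"
    then have "Ord y" using assms Ord_in_Ord by blast
    moreover from this have "succ y \<in> elts x \<or> succ y = x \<or> x \<in> elts (succ y)"
      by (intro Ord_linear assms) simp
    ultimately show "succ y \<in> elts x" using ns y mem_irrefl mem_asym by auto
  qed
  then show thesis using that by blast
qed

lemma Limit_not_zero: "Limit x \<Longrightarrow> x \<noteq> (zero :: 'v::zf)"
  by (simp add: Limit_def)

lemma Limit_not_succ: "\<not> Limit (succ (x :: 'v::zf))"
  using mem_irrefl[of "succ x"] by (auto simp: Limit_def)

lemma succ_not_zero [simp]: "succ x \<noteq> (zero :: 'v::zf)" "zero \<noteq> succ x"
  by (auto simp: elts_eq_iff)

text \<open>The times up to and including \<open>\<theta>\<close> are the elements of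
  \<open>succ \<theta>\<close>; this rule passes between a step taken before \<open>\<theta>\<close>
  and its result, reached at \<open>\<theta>\<close> at the latest.\<close>

lemma succ_mem_succ:
  "Ord x \<Longrightarrow> succ y \<in> elts (succ x) \<longleftrightarrow> y \<in> elts (x :: 'v::zf)"
proof -
  assume x: "Ord x"
  have "succ y \<in> elts x \<or> succ y = x" if y: "y \<in> elts x"
  proof -
    have "Ord (succ y)" using x y Ord_in_Ord by simp
    from Ord_linear[OF this x] show ?thesis using y mem_asym mem_irrefl by auto
  qed
  moreover have "y \<in> elts x" if "succ y \<in> elts x \<or> succ y = x"
    using that Ord_trans[OF x, of "succ y" y] by auto
  ultimately show ?thesis unfolding elts_succ insert_iff by blast
qed

text \<open>Finite ordinals represent line indices, so that these can be treated like register
  contents.\<close>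

primrec num :: "nat \<Rightarrow> 'v::zf" where
  "num 0 = zero"
| "num (Suc k) = succ (num k)"

lemma elts_num: "elts (num k) = num ` {..<k}"
  by (induction k) (auto simp: lessThan_Suc)

lemma Ord_num [simp]: "Ord (num k)"
  by (induction k) auto

lemma num_inject [simp]: "num k = (num l :: 'v::zf) \<longleftrightarrow> k = l"
proof (rule linorder_cases[of k l])
  assume "k < l"
  then have "num k \<in> elts (num l :: 'v)" by (simp add: elts_num)
  then show ?thesis using mem_irrefl[of "num l"] \<open>k < l\<close> by auto
next
  assume "l < k"
  then have "num l \<in> elts (num k :: 'v)" by (simp add: elts_num)
  then show ?thesis using mem_irrefl[of "num l"] \<open>l < k\<close> by auto
qed simp

section \<open>Relations defined by bounded formulas\<close>

primrec vars :: "fm \<Rightarrow> nat set" where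
  "vars (Mem i j) = {i, j}"
| "vars (Equal i j) = {i, j}"
| "vars (Neg \<phi>) = vars \<phi>"
| "vars (Conj \<phi> \<psi>) = vars \<phi> \<union> vars \<psi>"
| "vars (Exists i \<phi>) = insert i (vars \<phi>)"

text \<open>Bound variables are renamed as well; injectivity of \<open>f\<close> on
  \<open>vars\<close> then excludes capture.\<close>

primrec rename :: "(nat \<Rightarrow> nat) \<Rightarrow> fm \<Rightarrow> fm" where
  "rename f (Mem i j) = Mem (f i) (f j)"
| "rename f (Equal i j) = Equal (f i) (f j)"
| "rename f (Neg \<phi>) = Neg (rename f \<phi>)"
| "rename f (Conj \<phi> \<psi>) = Conj (rename f \<phi>) (rename f \<psi>)"
| "rename f (Exists i \<phi>) = Exists (f i) (rename f \<phi>)"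

lemma finite_vars [simp]: "finite (vars \<phi>)"
  by (induction \<phi>) auto

lemma fv_subset_vars: "fv \<phi> \<subseteq> vars \<phi>"
  by (induction \<phi>) auto

lemma sat_cong: "(\<And>i. i \<in> fv \<phi> \<Longrightarrow> s i = t i) \<Longrightarrow> sat M s \<phi> \<longleftrightarrow> sat M t \<phi>"
proof (induction \<phi> arbitrary: s t)
  case (Neg \<phi>)
  have "sat M s \<phi> \<longleftrightarrow> sat M t \<phi>" by (rule Neg.IH) (simp add: Neg.prems)
  then show ?case by simp
next
  case (Conj \<phi> \<psi>)
  have "sat M s \<phi> \<longleftrightarrow> sat M t \<phi>" by (rule Conj.IH(1)) (simp add: Conj.prems)
  moreover have "sat M s \<psi> \<longleftrightarrow> sat M t \<psi>" by (rule Conj.IH(2)) (simp add: Conj.prems)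
  ultimately show ?case by simp
next
  case (Exists i \<phi>)
  have "sat M (s(i := a)) \<phi> \<longleftrightarrow> sat M (t(i := a)) \<phi>" for a
    by (rule Exists.IH) (simp add: Exists.prems)
  then show ?case by simp
qed auto

text \<open>At a quantifier, injectivity keeps \<open>f i\<close> apart from the images of the other
  variables, so that updating at \<open>f i\<close> before composing with \<open>f\<close> amounts
  to updating at \<open>i\<close> afterwards.\<close>

lemma sat_rename:
  "inj_on f (vars \<phi>) \<Longrightarrow> sat M s (rename f \<phi>) \<longleftrightarrow> sat M (s \<circ> f) \<phi>"
proof (induction \<phi> arbitrary: s)
  case (Conj \<phi> \<psi>)
  then show ?case by (simp add: inj_on_Un)
next
  case (Exists i \<phi>)
  have "sat M (s(f i := a)) (rename f \<phi>) \<longleftrightarrow> sat M ((s \<circ> f)(i := a)) \<phi>" for a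
  proof -
    have "sat M (s(f i := a)) (rename f \<phi>) \<longleftrightarrow> sat M (s(f i := a) \<circ> f) \<phi>"
      by (rule Exists.IH) (use Exists.prems in \<open>simp add: inj_on_insert\<close>)
    also have "\<dots> \<longleftrightarrow> sat M ((s \<circ> f)(i := a)) \<phi>"
      using Exists.prems fv_subset_vars by (intro sat_cong) (auto simp: inj_on_def)
    finally show ?thesis .
  qed
  then show ?case by (simp add: comp_def)
qed auto

lemma Delta0_rename: "Delta0 \<phi> \<Longrightarrow> inj_on f (vars \<phi>) \<Longrightarrow> Delta0 (rename f \<phi>)"
  by (induction rule: Delta0.induct) (auto intro!: Delta0.intros simp: inj_on_Un)

text \<open>A bounded quantifier ranges over the elements of a member of \<open>M\<close>, and by
  transitivity these all lie in \<open>M\<close>, so no witness is lost.\<close>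

lemma Delta0_absolute:
  assumes "Delta0 \<phi>" "\<And>x. x \<in> M \<Longrightarrow> elts x \<subseteq> M" "s ` fv \<phi> \<subseteq> (M :: 'v::zf set)"
  shows "sat M s \<phi> \<longleftrightarrow> sat UNIV s \<phi>"
  using assms(1,3)
proof (induction arbitrary: s rule: Delta0.induct)
  case (5 \<phi> i j)
  have "sat M (s(i := a)) \<phi> \<longleftrightarrow> sat UNIV (s(i := a)) \<phi>" if "a \<in> M" for a
    using 5 that by (intro 5) auto
  moreover have "elts (s j) \<subseteq> M" using 5 assms(2) by auto
  ultimately show ?case using 5 by auto
qed auto

section \<open>Closure properties of bounded definability\<close>

text \<open>A semantic notion of definability by a bounded formula. It lets definability be derived
  by introduction rules that follow a HOL formula, without writing out any
  \<open>fm\<close>.\<close>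

definition D0 :: "((nat \<Rightarrow> 'v::zf) \<Rightarrow> bool) \<Rightarrow> bool" where
  "D0 R \<longleftrightarrow> (\<exists>\<phi>. Delta0 \<phi> \<and> (\<forall>s. R s \<longleftrightarrow> sat UNIV s \<phi>))"

lemma D0_mem: "D0 (\<lambda>s. s i \<in> elts (s j))"
  unfolding D0_def by (rule exI[of _ "Mem i j"]) (auto intro: Delta0.intros)

lemma D0_eq: "D0 (\<lambda>s. s i = s j)"
  unfolding D0_def by (rule exI[of _ "Equal i j"]) (auto intro: Delta0.intros)

lemma D0_not: "D0 R \<Longrightarrow> D0 (\<lambda>s. \<not> R s)"
  unfolding D0_def by (metis Delta0.intros(3) sat.simps(3))

lemma D0_conj: "D0 R \<Longrightarrow> D0 S \<Longrightarrow> D0 (\<lambda>s. R s \<and> S s)"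
  unfolding D0_def by (metis Delta0.intros(4) sat.simps(4))

lemma D0_disj: "D0 R \<Longrightarrow> D0 S \<Longrightarrow> D0 (\<lambda>s. R s \<or> S s)"
proof -
  assume "D0 R" "D0 S"
  then have "D0 (\<lambda>s. \<not> (\<not> R s \<and> \<not> S s))" by (intro D0_not D0_conj)
  then show ?thesis by simp
qed

lemma D0_imp: "D0 R \<Longrightarrow> D0 S \<Longrightarrow> D0 (\<lambda>s. R s \<longrightarrow> S s)"
  unfolding imp_conv_disj by (intro D0_disj D0_not)

lemma D0_iff: "D0 R \<Longrightarrow> D0 S \<Longrightarrow> D0 (\<lambda>s. R s \<longleftrightarrow> S s)"
  unfolding iff_conv_conj_imp by (intro D0_conj D0_imp)

lemma D0_const: "D0 (\<lambda>s. Q)"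
  using D0_eq[of 0 0] D0_not[OF D0_eq[of 0 0]] by (cases Q) auto

text \<open>A bounded quantifier binds variable 0 and shifts the other variables, as with de Bruijn indices.\<close>

lemma D0_bex:
  assumes "D0 (\<lambda>s. R (s 0) (\<lambda>n. s (Suc n)))"
  shows "D0 (\<lambda>s. \<exists>a\<in>elts (s j). R a s)"
proof -
  obtain \<phi> where \<phi>: "Delta0 \<phi>" and sat: "\<And>s. R (s 0) (\<lambda>n. s (Suc n)) \<longleftrightarrow> sat UNIV s \<phi>"
    using assms unfolding D0_def by blast
  obtain m where m: "\<forall>i\<in>insert j (vars \<phi>). i < m"
    using finite_nat_set_iff_bounded[of "insert j (vars \<phi>)"] by auto
  \<comment> \<open>Variable 0 moves to \<open>m\<close>, which exceeds \<open>j\<close> and all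
    variables of \<open>\<phi>\<close>; every other variable is shifted back by one.\<close>
  define f where "f = case_nat m (\<lambda>n. n)"
  have f: "inj_on f (vars \<phi>)"
    using m by (auto simp: inj_on_def f_def split: nat.splits)
  have "R a s \<longleftrightarrow> sat UNIV (s(m := a)) (rename f \<phi>)" for a s
  proof -
    have "R a s \<longleftrightarrow> sat UNIV (case_nat a s) \<phi>" using sat[of "case_nat a s"] by simp
    also have "\<dots> \<longleftrightarrow> sat UNIV (s(m := a) \<circ> f) \<phi>"
    proof (rule sat_cong)
      fix i assume "i \<in> fv \<phi>"
      then have "i < m" using m fv_subset_vars by blast
      then show "case_nat a s i = (s(m := a) \<circ> f) i" by (simp add: f_def split: nat.split)
    qed
    finally show ?thesis by (simp add: sat_rename[OF f])
  qed
  moreover have "Delta0 (Exists m (Conj (Mem m j) (rename f \<phi>)))"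
    using Delta0_rename[OF \<phi> f] m by (intro Delta0.intros) auto
  moreover have "j \<noteq> m" using m by auto
  ultimately show ?thesis
    unfolding D0_def by (intro exI[of _ "Exists m (Conj (Mem m j) (rename f \<phi>))"]) auto
qed

lemma D0_ball:
  assumes "D0 (\<lambda>s. R (s 0) (\<lambda>n. s (Suc n)))"
  shows "D0 (\<lambda>s. \<forall>a\<in>elts (s j). R a s)"
proof -
  have "D0 (\<lambda>s. \<not> (\<exists>a\<in>elts (s j). \<not> R a s))"
    by (intro D0_not D0_bex assms)
  then show ?thesis by simp
qed

text \<open>The index is a number of the metalevel, so that this is a finite conjunction and not a
  quantifier of the formula.\<close>

lemma D0_all_less: "(\<And>i. i < n \<Longrightarrow> D0 (R i)) \<Longrightarrow> D0 (\<lambda>s. \<forall>i<n. R i s)" for n :: nat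
  by (induction n) (auto simp: All_less_Suc intro: D0_const D0_conj)

lemma D0_ex_less: "(\<And>i. i < n \<Longrightarrow> D0 (R i)) \<Longrightarrow> D0 (\<lambda>s. \<exists>i<n. R i s)" for n :: nat
  by (induction n) (auto simp: Ex_less_Suc intro: D0_const D0_disj)

text \<open>The entries of the list are the variables below \<open>n\<close>.\<close>

lemma D0_ex_list:
  assumes "D0 (\<lambda>s. R (map (\<lambda>i. s i) [0..<n]) (\<lambda>k. s (k + n)))"
  shows "D0 (\<lambda>s. \<exists>vs. length vs = n \<and> set vs \<subseteq> elts (s j) \<and> R vs s)"
  using assms
proof (induction n arbitrary: R j)
  case 0
  then show ?case by simp
next
  case (Suc n)
  \<comment> \<open>The last entry is quantified outermost. Behind the \<open>n\<close> quantifiers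
    of the induction hypothesis it becomes variable \<open>n\<close>, as the order of the list
    demands.\<close>
  have "D0 (\<lambda>s. \<exists>vs. length vs = n \<and> set vs \<subseteq> elts (s (Suc j)) \<and>
                  R (vs @ [s 0]) (\<lambda>k. s (Suc k)))"
    by (rule Suc.IH) (use Suc.prems in simp)
  then have "D0 (\<lambda>s. \<exists>a\<in>elts (s j). \<exists>vs. length vs = n \<and> set vs \<subseteq> elts (s j) \<and> R (vs @ [a]) s)"
    by (rule D0_bex)
  moreover have "(\<exists>a\<in>elts (s j). \<exists>vs. length vs = n \<and> set vs \<subseteq> elts (s j) \<and> R (vs @ [a]) s)
      \<longleftrightarrow> (\<exists>vs. length vs = Suc n \<and> set vs \<subseteq> elts (s j) \<and> R vs s)" for s
  proof
    assume "\<exists>vs. length vs = Suc n \<and> set vs \<subseteq> elts (s j) \<and> R vs s"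
    then obtain vs where vs: "length vs = Suc n" "set vs \<subseteq> elts (s j)" "R vs s" by blast
    then obtain us a where "vs = us @ [a]" by (cases vs rule: rev_cases) auto
    with vs show "\<exists>a\<in>elts (s j). \<exists>vs. length vs = n \<and> set vs \<subseteq> elts (s j) \<and> R (vs @ [a]) s"
      by auto
  next
    assume "\<exists>a\<in>elts (s j). \<exists>vs. length vs = n \<and> set vs \<subseteq> elts (s j) \<and> R (vs @ [a]) s"
    then obtain a vs where "a \<in> elts (s j)" "length vs = n" "set vs \<subseteq> elts (s j)" "R (vs @ [a]) s"
      by blast
    then show "\<exists>vs. length vs = Suc n \<and> set vs \<subseteq> elts (s j) \<and> R vs s"
      by (intro exI[of _ "vs @ [a]"]) auto
  qed
  ultimately show ?case by simp
qed

lemmas D0_intros = D0_mem D0_eq D0_not D0_conj D0_disj D0_imp D0_iff D0_bex D0_ball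

section \<open>Bounded definitions of the basic set-theoretic notions\<close>

lemma D0_subset: "D0 (\<lambda>s. elts (s i) \<subseteq> elts (s j))"
  unfolding subset_iff Ball_def[symmetric] by (intro D0_intros)

lemma D0_is_zero: "D0 (\<lambda>s. s i = zero)"
proof -
  have "s i = zero \<longleftrightarrow> (\<forall>z\<in>elts (s i). False)" for s :: "nat \<Rightarrow> 'a"
    by (auto simp: elts_eq_iff)
  then show ?thesis by (simp only:) (intro D0_intros D0_const)
qed

lemma D0_is_succ: "D0 (\<lambda>s. s i = succ (s j))"
proof -
  have "s i = succ (s j) \<longleftrightarrow> s j \<in> elts (s i) \<and> (\<forall>z\<in>elts (s i). z = s j \<or> z \<in> elts (s j)) \<and>
      (\<forall>z\<in>elts (s j). z \<in> elts (s i))" for s :: "nat \<Rightarrow> 'a"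
    unfolding elts_eq_iff[of "s i"] by auto
  then show ?thesis by (simp only:) (intro D0_intros)
qed

lemma D0_is_num: "D0 (\<lambda>s. s i = num k)"
proof (induction k arbitrary: i)
  case 0
  then show ?case by (simp add: D0_is_zero)
next
  case (Suc k)
  have "s i = num (Suc k) \<longleftrightarrow> (\<exists>z\<in>elts (s i). s i = succ z \<and> z = num k)" for s :: "nat \<Rightarrow> 'a"
    by auto
  then show ?case by (simp only:) (intro D0_intros D0_is_succ Suc)
qed

lemma D0_is_opair: "D0 (\<lambda>s. s i = opair (s j) (s k))"
proof -
  have "s i = opair (s j) (s k) \<longleftrightarrow>
      (\<exists>u\<in>elts (s i). \<exists>w\<in>elts (s i). (\<forall>z\<in>elts (s i). z = u \<or> z = w) \<and>
         (\<forall>z\<in>elts u. z = s j) \<and> s j \<in> elts u \<and>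
         (\<forall>z\<in>elts w. z = s j \<or> z = s k) \<and> s j \<in> elts w \<and> s k \<in> elts w)" (is "_ \<longleftrightarrow> ?R s")
    for s :: "nat \<Rightarrow> 'a"
  proof
    assume "?R s"
    then obtain u w where "elts (s i) = {u, w}" "elts u = {s j}" "elts w = {s j, s k}" by blast
    then have "elts (s i) = {u, w}" "u = set_of {s j}" "w = set_of {s j, s k}"
      using set_of_elts by metis+
    then show "s i = opair (s j) (s k)" by (simp add: elts_eq_iff elts_opair)
  qed (simp add: elts_opair)
  then show ?thesis by (simp only:) (intro D0_intros)
qed

lemma D0_opair_mem: "D0 (\<lambda>s. opair (s j) (s k) \<in> elts (s i))"
proof -
  have "opair (s j) (s k) \<in> elts (s i) \<longleftrightarrow> (\<exists>p\<in>elts (s i). p = opair (s j) (s k))"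
    for s :: "nat \<Rightarrow> 'a" by blast
  then show ?thesis by (simp only:) (intro D0_intros D0_is_opair)
qed

lemma D0_Ord: "D0 (\<lambda>s. Ord (s i))"
  unfolding Ord_def transitive_def by (intro D0_intros D0_subset)

lemma D0_Limit: "D0 (\<lambda>s. Limit (s i))"
proof -
  have "Limit (s i) \<longleftrightarrow> Ord (s i) \<and> s i \<noteq> zero \<and>
      (\<forall>z\<in>elts (s i). \<exists>w\<in>elts (s i). w = succ z)" for s :: "nat \<Rightarrow> 'a"
    unfolding Limit_def by blast
  then show ?thesis by (simp only:) (intro D0_intros D0_Ord D0_is_zero D0_is_succ)
qed

section \<open>The constructible hierarchy\<close>

text \<open>All definable subsets lie in the power set of \<open>A\<close>, so that they form a
  set.\<close>

lemma elts_Def: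
  "elts (Def (A :: 'v::zf)) =
     {set_of {a \<in> elts A. sat (elts A) (s(0 := a)) \<phi>} | \<phi> s. s ` (fv \<phi> - {0}) \<subseteq> elts A}"
proof -
  obtain p :: 'v where p: "elts p = {y. elts y \<subseteq> elts A}" using power_set by blast
  show ?thesis
    unfolding Def_def
    by (rule elts_set_of[of _ p]) (auto simp: p elts_set_of[of _ A])
qed

lemma Def_subset: "x \<in> elts (Def A) \<Longrightarrow> elts x \<subseteq> elts (A :: 'v::zf)"
  by (auto simp: elts_Def elts_set_of[of _ A])

lemma self_in_Def: "(A :: 'v::zf) \<in> elts (Def A)"
proof -
  have "A = set_of {a \<in> elts A. sat (elts A) (undefined(0 := a)) (Equal 0 0)}" by simp
  then show ?thesis
    unfolding elts_Def by (intro CollectI exI[of _ "Equal 0 0"] exI[of _ undefined] conjI) auto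
qed

text \<open>By absoluteness a bounded predicate has the same meaning over the transitive set
  \<open>A\<close> as in the universe, so that what it cuts out of \<open>A\<close> is definable
  over \<open>A\<close>. By \<open>cong\<close> the predicate depends on the first \<open>k\<close>
  parameters only, and just these have to lie in \<open>A\<close>.\<close>

lemma D0_in_Def:
  assumes "D0 (\<lambda>s. R (s 0) (\<lambda>n. s (Suc n)))" and tr: "\<And>x. x \<in> elts A \<Longrightarrow> elts x \<subseteq> elts A"
    and cong: "\<And>a t. (\<And>n. n < k \<Longrightarrow> t n = s n) \<Longrightarrow> R a t \<longleftrightarrow> R a s"
    and s: "\<And>n. n < k \<Longrightarrow> s n \<in> elts A"
  shows "set_of {a \<in> elts A. R a s} \<in> elts (Def (A :: 'v::zf))"
proof (cases "elts A = {}")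
  case True
  then have "{a \<in> elts A. R a s} = elts A" by blast
  then show ?thesis using self_in_Def[of A] by simp
next
  case False
  then obtain a0 where a0: "a0 \<in> elts A" by blast
  obtain \<phi> where \<phi>: "Delta0 \<phi>" and sat: "\<And>t. R (t 0) (\<lambda>n. t (Suc n)) \<longleftrightarrow> sat UNIV t \<phi>"
    using assms(1) unfolding D0_def by blast
  \<comment> \<open>The default \<open>a0\<close> brings all remaining variables into
    \<open>A\<close>, as absoluteness requires for the free ones. This is why empty \<open>A\<close>
    is a separate case.\<close>
  define t where "t = case_nat a0 (\<lambda>n. if n < k then s n else a0)"
  have t: "t n \<in> elts A" for n
    using a0 s by (simp add: t_def split: nat.split)
  have "R a s \<longleftrightarrow> sat (elts A) (t(0 := a)) \<phi>" if a: "a \<in> elts A" for a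
  proof -
    have "R a s \<longleftrightarrow> R a (\<lambda>n. (t(0 := a)) (Suc n))"
      using cong[of "\<lambda>n. (t(0 := a)) (Suc n)" a] by (simp add: t_def)
    also have "\<dots> \<longleftrightarrow> sat UNIV (t(0 := a)) \<phi>" using sat[of "t(0 := a)"] by simp
    also have "\<dots> \<longleftrightarrow> sat (elts A) (t(0 := a)) \<phi>"
      using t a by (intro Delta0_absolute[symmetric] \<phi> tr) auto
    finally show ?thesis .
  qed
  then have "{a \<in> elts A. R a s} = {a \<in> elts A. sat (elts A) (t(0 := a)) \<phi>}" by blast
  moreover have "t ` (fv \<phi> - {0}) \<subseteq> elts A" using t by blast
  ultimately show ?thesis unfolding elts_Def by (intro CollectI exI[of _ \<phi>] exI[of _ t]) simp
qed

text \<open>An element \<open>x\<close> of a transitive set is defined over it by membership in the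
  parameter \<open>x\<close>.\<close>

lemma subset_Def:
  assumes "\<And>x. x \<in> elts A \<Longrightarrow> elts x \<subseteq> elts (A :: 'v::zf)"
  shows "elts A \<subseteq> elts (Def A)"
proof
  fix x assume x: "x \<in> elts A"
  have "set_of {a \<in> elts A. a \<in> elts ((\<lambda>_. x) 0)} \<in> elts (Def A)"
    by (rule D0_in_Def[where k = 1 and R = "\<lambda>a t. a \<in> elts (t 0)"])
       (auto intro: D0_mem simp: x assms)
  moreover have "{a \<in> elts A. a \<in> elts x} = elts x" using assms x by blast
  ultimately show "x \<in> elts (Def A)" by simp
qed

lemma elts_Lset_Union:
  "\<nexists>\<delta>. \<gamma> = succ \<delta> \<Longrightarrow> elts (Lset (\<gamma> :: 'v::zf)) = (\<Union>\<delta>\<in>elts \<gamma>. elts (Lset \<delta>))"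
  by (subst Lset.simps) (simp only: if_False elts_UN)

lemma elts_Lset_Limit: "Limit \<mu> \<Longrightarrow> elts (Lset (\<mu> :: 'v::zf)) = (\<Union>\<delta>\<in>elts \<mu>. elts (Lset \<delta>))"
  using Limit_not_succ by (intro elts_Lset_Union) blast

text \<open>The two claims need a joint induction: at a successor, transitivity of the previous
  level yields its inclusion in the new one by \<open>subset_Def\<close>, and this inclusion makes
  the new level transitive.\<close>

lemma Lset_transitive_mono:
  assumes "Ord (\<gamma> :: 'v::zf)"
  shows "(\<forall>x\<in>elts (Lset \<gamma>). elts x \<subseteq> elts (Lset \<gamma>)) \<and> (\<forall>\<delta>\<in>elts \<gamma>. elts (Lset \<delta>) \<subseteq> elts (Lset \<gamma>))"
  using assms
proof (induction \<gamma> rule: mem_induct)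
  case (mem \<gamma>)
  from mem.prems show ?case
  proof (cases rule: Ord_cases)
    case 1
    then show ?thesis by (simp add: Lset_zero)
  next
    case (2 \<delta>)
    then have IH: "\<forall>x\<in>elts (Lset \<delta>). elts x \<subseteq> elts (Lset \<delta>)"
      "\<forall>\<epsilon>\<in>elts \<delta>. elts (Lset \<epsilon>) \<subseteq> elts (Lset \<delta>)"
      using mem.IH[of \<delta>] by auto
    have "elts (Lset \<delta>) \<subseteq> elts (Def (Lset \<delta>))" using IH(1) by (intro subset_Def) blast
    then show ?thesis
      unfolding 2(2) Lset_succ using IH(2) Def_subset[of _ "Lset \<delta>"] by (simp; blast)
  next
    case 3
    show ?thesis
      unfolding elts_Lset_Limit[OF 3] using mem.IH Ord_in_Ord[OF mem.prems] by blast
  qed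
qed

lemma Lset_transitive:
  "Ord \<gamma> \<Longrightarrow> y \<in> elts x \<Longrightarrow> x \<in> elts (Lset \<gamma>) \<Longrightarrow> y \<in> elts (Lset (\<gamma> :: 'v::zf))"
  using Lset_transitive_mono by blast

lemma Lset_mono:
  "Ord \<gamma> \<Longrightarrow> \<delta> \<in> elts \<gamma> \<Longrightarrow> elts (Lset \<delta>) \<subseteq> elts (Lset (\<gamma> :: 'v::zf))"
  using Lset_transitive_mono by blast

text \<open>At a successor \<open>succ \<delta>\<close>, an ordinal of the new level consists of
  ordinals below \<open>\<delta>\<close> and is thus at most \<open>\<delta>\<close>. Conversely,
  \<open>\<delta>\<close> is the set of all ordinals of the previous level and is definable there,
  being an ordinal is a bounded property.\<close>

lemma Ord_in_Lset_iff:
  assumes "Ord (\<gamma> :: 'v::zf)" "Ord x"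
  shows "x \<in> elts (Lset \<gamma>) \<longleftrightarrow> x \<in> elts \<gamma>"
  using assms
proof (induction \<gamma> arbitrary: x rule: mem_induct)
  case (mem \<gamma>)
  from mem.prems(1) show ?case
  proof (cases rule: Ord_cases)
    case 1
    then show ?thesis by (simp add: Lset_zero)
  next
    case (2 \<delta>)
    have IH: "y \<in> elts (Lset \<delta>) \<longleftrightarrow> y \<in> elts \<delta>" if "Ord y" for y
      using mem.IH[of \<delta>] 2 that by simp
    show ?thesis
    proof
      assume x: "x \<in> elts (Lset \<gamma>)"
      then have "elts x \<subseteq> elts (Lset \<delta>)" using Def_subset by (simp add: 2 Lset_succ)
      then have "elts x \<subseteq> elts \<delta>" using IH Ord_in_Ord[OF mem.prems(2)] by blast
      then show "x \<in> elts \<gamma>" using Ord_subset_iff mem.prems 2 by blast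
    next
      assume "x \<in> elts \<gamma>"
      then have "x = \<delta> \<or> x \<in> elts \<delta>" using 2 by simp
      then show "x \<in> elts (Lset \<gamma>)"
      proof
        assume "x = \<delta>"
        have "set_of {a \<in> elts (Lset \<delta>). Ord a} \<in> elts (Def (Lset \<delta>))"
          by (rule D0_in_Def[where k = 0 and R = "\<lambda>a t. Ord a"])
             (use Lset_transitive 2 in \<open>auto intro: D0_Ord\<close>)
        moreover have "{a \<in> elts (Lset \<delta>). Ord a} = elts \<delta>"
          using IH Ord_in_Ord[OF 2(1)] by blast
        ultimately show ?thesis using \<open>x = \<delta>\<close> 2 by (simp add: Lset_succ)
      next
        assume "x \<in> elts \<delta>"
        then show ?thesis using IH[OF mem.prems(2)] Lset_mono[OF mem.prems(1), of \<delta>] 2 by auto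
      qed
    qed
  next
    case 3
    have IH: "x \<in> elts (Lset \<delta>) \<longleftrightarrow> x \<in> elts \<delta>" if "\<delta> \<in> elts \<gamma>" for \<delta>
      using mem.IH[OF that] mem.prems Ord_in_Ord that by blast
    have "x \<in> elts (Lset \<gamma>) \<longleftrightarrow> (\<exists>\<delta>\<in>elts \<gamma>. x \<in> elts \<delta>)"
      unfolding elts_Lset_Limit[OF 3] using IH by blast
    also have "\<dots> \<longleftrightarrow> x \<in> elts \<gamma>"
    proof
      assume "x \<in> elts \<gamma>"
      then have "succ x \<in> elts \<gamma>" using 3 by (simp add: Limit_def)
      then show "\<exists>\<delta>\<in>elts \<gamma>. x \<in> elts \<delta>" by (intro bexI[of _ "succ x"]) auto
    next
      assume "\<exists>\<delta>\<in>elts \<gamma>. x \<in> elts \<delta>"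
      then show "x \<in> elts \<gamma>" using Ord_trans[OF mem.prems(1)] by blast
    qed
    finally show ?thesis .
  qed
qed

section \<open>Closure properties of the constructible universe\<close>

lemma constructibleE:
  assumes "x \<in> constructible"
  obtains \<gamma> :: "'v::zf" where "Ord \<gamma>" "x \<in> elts (Lset \<gamma>)"
  using assms unfolding constructible_def by blast

lemma constructibleI: "Ord \<gamma> \<Longrightarrow> x \<in> elts (Lset \<gamma>) \<Longrightarrow> x \<in> (constructible :: 'v::zf set)"
  unfolding constructible_def by blast

lemma constructible_transitive:
  "x \<in> constructible \<Longrightarrow> y \<in> elts x \<Longrightarrow> y \<in> (constructible :: 'v::zf set)"
  by (meson constructibleE constructibleI Lset_transitive)

lemma Lset_constructible: "Ord \<gamma> \<Longrightarrow> Lset \<gamma> \<in> (constructible :: 'v::zf set)"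
  using self_in_Def[of "Lset \<gamma>"] by (intro constructibleI[of "succ \<gamma>"]) (auto simp: Lset_succ)

lemma Ord_constructible: "Ord x \<Longrightarrow> x \<in> (constructible :: 'v::zf set)"
  using Ord_in_Lset_iff[of "succ x" x] by (intro constructibleI[of "succ x"]) auto

text \<open>Choose a level for each element; the union of the successors of their indices is an
  ordinal above all these indices.\<close>

lemma constructible_cover:
  fixes x :: "'v::zf"
  assumes "elts x \<subseteq> constructible"
  obtains \<gamma> where "Ord \<gamma>" "elts x \<subseteq> elts (Lset \<gamma>)"
proof -
  have "\<forall>y\<in>elts x. \<exists>\<gamma>. Ord \<gamma> \<and> y \<in> elts (Lset \<gamma>)"
    using assms by (meson constructibleE subsetD)
  then obtain F where F: "\<And>y. y \<in> elts x \<Longrightarrow> Ord (F y) \<and> y \<in> elts (Lset (F y))" by metis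
  define \<gamma> where "\<gamma> = set_of (\<Union>y\<in>elts x. elts (succ (F y)))"
  have elts: "elts \<gamma> = (\<Union>y\<in>elts x. elts (succ (F y)))"
    unfolding \<gamma>_def by (rule elts_UN)
  have \<gamma>: "Ord \<gamma>"
    unfolding \<gamma>_def by (rule Ord_UN) (simp add: F)
  moreover have "y \<in> elts (Lset \<gamma>)" if "y \<in> elts x" for y
    using F[OF that] Lset_mono[OF \<gamma>, of "F y"] that by (auto simp: elts)
  ultimately show thesis using that by blast
qed

lemma constructible_cover_finite:
  assumes "finite A" "A \<subseteq> (constructible :: 'v::zf set)"
  obtains \<gamma> where "Ord \<gamma>" "A \<subseteq> elts (Lset \<gamma>)"
  using finite_is_set[OF assms(1)] constructible_cover assms(2) by metis

text \<open>One level contains the bound \<open>A\<close> and all relevant parameters. By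
  transitivity it contains every \<open>a\<close> satisfying the predicate, and
  \<open>D0_in_Def\<close> places the resulting set in the next level.\<close>

lemma constructible_separation:
  fixes A :: "'v::zf"
  assumes "D0 (\<lambda>s. R (s 0) (\<lambda>n. s (Suc n)))" and bounded: "\<And>a. R a s \<Longrightarrow> a \<in> elts A"
    and cong: "\<And>a t. (\<And>n. n < k \<Longrightarrow> t n = s n) \<Longrightarrow> R a t \<longleftrightarrow> R a s"
    and A: "A \<in> constructible" and s: "\<And>n. n < k \<Longrightarrow> s n \<in> constructible"
  shows "set_of {a. R a s} \<in> constructible" "elts (set_of {a. R a s}) = {a. R a s}"
proof -
  have "finite (insert A (s ` {..<k}))" "insert A (s ` {..<k}) \<subseteq> constructible"
    using A s by auto
  then obtain \<gamma> where \<gamma>: "Ord \<gamma>" and sub: "insert A (s ` {..<k}) \<subseteq> elts (Lset \<gamma>)"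
    by (rule constructible_cover_finite)
  have "set_of {a \<in> elts (Lset \<gamma>). R a s} \<in> elts (Def (Lset \<gamma>))"
  proof (rule D0_in_Def[OF assms(1), where k = k])
    show "R a t \<longleftrightarrow> R a s" if "\<And>n. n < k \<Longrightarrow> t n = s n" for a t
      using that by (rule cong)
  qed (use Lset_transitive[OF \<gamma>] sub in blast)+
  moreover have "{a \<in> elts (Lset \<gamma>). R a s} = {a. R a s}"
    using bounded Lset_transitive[OF \<gamma>] sub by blast
  ultimately show "set_of {a. R a s} \<in> constructible"
    using \<gamma> by (intro constructibleI[of "succ \<gamma>"]) (auto simp: Lset_succ)
  show "elts (set_of {a. R a s}) = {a. R a s}"
    by (rule elts_set_of[of _ A]) (use bounded in blast)
qed

lemma upair_constructible:
  assumes "x \<in> constructible" "y \<in> constructible"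
  shows "set_of {x, y :: 'v::zf} \<in> constructible"
proof -
  obtain \<gamma> where \<gamma>: "Ord \<gamma>" "{x, y} \<subseteq> elts (Lset \<gamma>)"
    by (rule constructible_cover_finite[of "{x, y}"]) (use assms in auto)
  define s where "s = (\<lambda>n :: nat. if n = 0 then x else y)"
  have "set_of {a. (\<lambda>a t. a = t 0 \<or> a = t 1) a s} \<in> constructible"
    by (rule constructible_separation[where k = 2 and A = "Lset \<gamma>"])
       (use \<gamma> assms in \<open>auto intro!: D0_intros Lset_constructible simp: s_def\<close>)
  moreover have "{a. a = x \<or> a = y} = {x, y}" by blast
  ultimately show ?thesis by (simp add: s_def)
qed

lemma opair_constructible:
  "x \<in> constructible \<Longrightarrow> y \<in> constructible \<Longrightarrow> opair x (y :: 'v::zf) \<in> constructible"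
  unfolding opair_def using upair_constructible[of x x] by (simp add: upair_constructible)

lemma insert_constructible:
  assumes "x \<in> constructible" "y \<in> constructible"
  shows "set_of (insert y (elts x)) \<in> (constructible :: 'v::zf set)"
proof -
  obtain \<gamma> where \<gamma>: "Ord \<gamma>" "{x, y} \<subseteq> elts (Lset \<gamma>)"
    by (rule constructible_cover_finite[of "{x, y}"]) (use assms in auto)
  define s where "s = (\<lambda>n :: nat. if n = 0 then x else y)"
  have "set_of {a. (\<lambda>a t. a \<in> elts (t 0) \<or> a = t 1) a s} \<in> constructible"
    by (rule constructible_separation[where k = 2 and A = "Lset \<gamma>"])
       (use \<gamma> assms Lset_transitive[OF \<gamma>(1)] in
         \<open>auto intro!: D0_intros Lset_constructible simp: s_def\<close>)
  moreover have "{a. a \<in> elts x \<or> a = y} = insert y (elts x)" by blast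
  ultimately show ?thesis by (simp add: s_def)
qed

lemma Int_constructible:
  assumes "x \<in> constructible" "y \<in> constructible"
  shows "set_of (elts x \<inter> elts y) \<in> (constructible :: 'v::zf set)"
proof -
  define s where "s = (\<lambda>n :: nat. if n = 0 then x else y)"
  have "set_of {a. (\<lambda>a t. a \<in> elts (t 0) \<and> a \<in> elts (t 1)) a s} \<in> constructible"
    by (rule constructible_separation[where k = 2 and A = x])
       (use assms in \<open>auto intro!: D0_intros simp: s_def\<close>)
  moreover have "{a. a \<in> elts x \<and> a \<in> elts y} = elts x \<inter> elts y" by blast
  ultimately show ?thesis by (simp add: s_def)
qed

text \<open>The bounded matrix is absolute for both transitive classes, so that elementarity
  concerns the existential quantifier alone. A single witness suffices for applications, since
  several objects can be collected as elements of one set.\<close>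

lemma Sigma1_reflection:
  assumes elem: "Sigma1_elementary M (constructible :: 'v::zf set)"
    and M: "\<And>x y. x \<in> M \<Longrightarrow> y \<in> elts x \<Longrightarrow> y \<in> M"
    and D0: "D0 (\<lambda>s. R (s 0) (s 1))"
    and p: "p \<in> M" and w: "w \<in> constructible" "R w p"
  shows "\<exists>w\<in>M. R w p"
proof -
  obtain \<phi> where \<phi>: "Delta0 \<phi>" and sat: "\<And>t. R (t 0) (t 1) \<longleftrightarrow> sat UNIV t \<phi>"
    using D0 unfolding D0_def by blast
  have MC: "M \<subseteq> constructible" using elem unfolding Sigma1_elementary_def by blast
  have sat_iff: "sat N ((\<lambda>_. p)(0 := a)) \<phi> \<longleftrightarrow> R a p"
    if "a \<in> N" "p \<in> N" "\<And>x. x \<in> N \<Longrightarrow> elts x \<subseteq> N" for a N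
    using Delta0_absolute[OF \<phi>, of N "(\<lambda>_. p)(0 := a)"] sat[of "(\<lambda>_. p)(0 := a)"] that by auto
  have "sat constructible (\<lambda>_. p) (Exists 0 \<phi>)"
    using w p MC sat_iff[of w constructible] constructible_transitive by auto
  moreover have "Sigma1 (Exists 0 \<phi>)" using \<phi> by (intro Sigma1.intros)
  moreover have "(\<lambda>_. p) ` fv (Exists 0 \<phi>) \<subseteq> M" using p by auto
  ultimately have "sat M (\<lambda>_. p) (Exists 0 \<phi>)"
    using elem unfolding Sigma1_elementary_def by blast
  then obtain a where "a \<in> M" "sat M ((\<lambda>_. p)(0 := a)) \<phi>" by auto
  then show ?thesis using sat_iff[of a M] M p by blast
qed

section \<open>Computations\<close>

lemma elts_ord_liminf:
  "elts (ord_liminf \<mu> f) = (\<Union>\<sigma>\<in>elts \<mu>. \<Inter>\<tau>\<in>{\<tau> \<in> elts \<mu>. elts \<sigma> \<subseteq> elts \<tau>}. elts (f \<tau>))"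
  unfolding ord_liminf_def
proof (rule elts_set_of)
  show "(\<Union>\<sigma>\<in>elts \<mu>. \<Inter>\<tau>\<in>{\<tau> \<in> elts \<mu>. elts \<sigma> \<subseteq> elts \<tau>}. elts (f \<tau>))
      \<subseteq> elts (set_of (\<Union>\<tau>\<in>elts \<mu>. elts (f \<tau>)))"
    unfolding elts_UN by blast
qed

text \<open>Read as eventual membership, the inferior limit can be expressed by bounded
  quantifiers.\<close>

lemma mem_ord_liminf:
  "z \<in> elts (ord_liminf \<mu> f) \<longleftrightarrow>
     (\<exists>\<sigma>\<in>elts \<mu>. \<forall>\<tau>\<in>elts \<mu>. elts \<sigma> \<subseteq> elts \<tau> \<longrightarrow> z \<in> elts (f \<tau>))"
  unfolding elts_ord_liminf by blast

lemma ord_liminf_cong: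
  "(\<And>\<tau>. \<tau> \<in> elts \<mu> \<Longrightarrow> f \<tau> = g \<tau>) \<Longrightarrow> ord_liminf \<mu> f = ord_liminf \<mu> g"
  unfolding elts_eq_iff elts_ord_liminf by (intro SUP_cong INF_cong) auto

lemma nat_liminf_cong:
  "(\<And>\<tau>. \<tau> \<in> elts \<mu> \<Longrightarrow> f \<tau> = g \<tau>) \<Longrightarrow> nat_liminf \<mu> f = nat_liminf \<mu> g"
  unfolding nat_liminf_def by (intro arg_cong[where f = Sup] image_cong arg_cong[where f = Inf]) auto

lemma ord_liminf_zero: "ord_liminf \<mu> (\<lambda>_. zero) = zero"
  by (auto simp: elts_eq_iff[of "ord_liminf _ _"] mem_ord_liminf)

text \<open>The bound \<open>K\<close> makes the outer supremum one of a bounded set of numbers, so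
  that exceeding \<open>j\<close> is witnessed by a single \<open>\<sigma>\<close>. This is the
  counterpart of \<open>mem_ord_liminf\<close>.\<close>

lemma less_nat_liminf_iff:
  assumes "\<mu> \<noteq> zero" "\<And>\<tau>. \<tau> \<in> elts \<mu> \<Longrightarrow> f \<tau> < K"
  shows "j < nat_liminf \<mu> f \<longleftrightarrow> (\<exists>\<sigma>\<in>elts \<mu>. \<forall>\<tau>\<in>elts \<mu>. elts \<sigma> \<subseteq> elts \<tau> \<longrightarrow> j < f \<tau>)"
proof -
  let ?I = "\<lambda>\<sigma>. INF \<tau>\<in>{\<tau> \<in> elts \<mu>. elts \<sigma> \<subseteq> elts \<tau>}. f \<tau>"
  have I_le: "?I \<sigma> \<le> f \<tau>" if "\<tau> \<in> elts \<mu>" "elts \<sigma> \<subseteq> elts \<tau>" for \<sigma> \<tau>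
    using that by (intro cINF_lower) auto
  have less_I: "j < ?I \<sigma> \<longleftrightarrow> (\<forall>\<tau>\<in>elts \<mu>. elts \<sigma> \<subseteq> elts \<tau> \<longrightarrow> j < f \<tau>)" if "\<sigma> \<in> elts \<mu>" for \<sigma>
  proof
    assume "\<forall>\<tau>\<in>elts \<mu>. elts \<sigma> \<subseteq> elts \<tau> \<longrightarrow> j < f \<tau>"
    then have "Suc j \<le> ?I \<sigma>" using that by (intro cINF_greatest) auto
    then show "j < ?I \<sigma>" by simp
  qed (use I_le in \<open>meson less_le_trans\<close>)
  have "elts \<mu> \<noteq> {}" using assms(1) by (auto simp: elts_eq_iff)
  moreover have "bdd_above (?I ` elts \<mu>)"
    using I_le assms(2) by (intro bdd_aboveI2[of _ _ K]) (meson less_imp_le order_refl le_trans)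
  ultimately have "j < nat_liminf \<mu> f \<longleftrightarrow> (\<exists>\<sigma>\<in>elts \<mu>. j < ?I \<sigma>)"
    unfolding nat_liminf_def by (rule less_cSUP_iff)
  then show ?thesis using less_I by blast
qed

text \<open>This allows the line index to be handled as one more register at limit times.\<close>

lemma ord_liminf_num:
  assumes "\<mu> \<noteq> zero" "\<And>\<tau>. \<tau> \<in> elts \<mu> \<Longrightarrow> f \<tau> < K"
  shows "ord_liminf \<mu> (\<lambda>\<tau>. num (f \<tau>)) = num (nat_liminf \<mu> f)"
proof -
  obtain \<mu>0 where \<mu>0: "\<mu>0 \<in> elts \<mu>" using assms(1) by (auto simp: elts_eq_iff)
  have num_mem: "num j \<in> elts (num k :: 'a) \<longleftrightarrow> j < k" for j k
    by (auto simp: elts_num)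
  have "z \<in> elts (ord_liminf \<mu> (\<lambda>\<tau>. num (f \<tau>))) \<longleftrightarrow> z \<in> elts (num (nat_liminf \<mu> f))" for z
  proof (cases "\<exists>j. z = num j")
    case True
    then obtain j where "z = num j" by blast
    then show ?thesis
      unfolding mem_ord_liminf by (simp only: num_mem less_nat_liminf_iff[OF assms])
  next
    case False
    then have "z \<notin> elts (num k)" for k by (auto simp: elts_num)
    then show ?thesis unfolding mem_ord_liminf by blast
  qed
  then show ?thesis by (intro extensionality) blast
qed

section \<open>Uniqueness of computations and their dependence on the oracle\<close>

lemma computationD:
  assumes "computation \<alpha> P x ins \<theta> c"
  shows "Ord \<theta>" "c zero = initial ins"
    "\<And>\<tau>. \<tau> \<in> elts \<theta> \<Longrightarrow> fst (c \<tau>) < length P"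
    "\<And>\<tau>. \<tau> \<in> elts \<theta> \<Longrightarrow> c (succ \<tau>) = step P x (c \<tau>)"
    "\<And>\<mu>. \<mu> \<in> elts (succ \<theta>) \<Longrightarrow> Limit \<mu> \<Longrightarrow>
       c \<mu> = (nat_liminf \<mu> (\<lambda>\<tau>. fst (c \<tau>)), \<lambda>i. ord_liminf \<mu> (\<lambda>\<tau>. snd (c \<tau>) i))"
    "\<And>\<tau> i. \<tau> \<in> elts (succ \<theta>) \<Longrightarrow> snd (c \<tau>) i \<in> elts \<alpha>"
  using assms unfolding computation_def by blast+

text \<open>Earlier values determine later ones. The register bounds may differ, because
  certificates use bounds other than \<open>\<alpha>\<close>.\<close>

lemma computation_unique:
  assumes c: "computation \<alpha> P x ins \<theta> c" and c': "computation \<alpha>' P x ins \<theta>' c'"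
    and "\<tau> \<in> elts (succ \<theta>)" "\<tau> \<in> elts (succ \<theta>')"
  shows "c \<tau> = c' (\<tau> :: 'v::zf)"
  using assms(3,4)
proof (induction \<tau> rule: mem_induct)
  case (mem \<tau>)
  have ord: "Ord (succ \<theta>)" "Ord (succ \<theta>')" using computationD(1) c c' by auto
  have "Ord \<tau>" using Ord_in_Ord ord mem.prems by blast
  then show ?case
  proof (cases rule: Ord_cases)
    case 1
    then show ?thesis using computationD(2) c c' by metis
  next
    case (2 \<sigma>)
    then have \<sigma>: "\<sigma> \<in> elts \<theta>" "\<sigma> \<in> elts \<theta>'"
      using mem.prems succ_mem_succ ord Ord_succ by metis+
    then have "c \<sigma> = c' \<sigma>" using mem.IH[of \<sigma>] 2 by simp
    then show ?thesis using computationD(4)[OF c \<sigma>(1)] computationD(4)[OF c' \<sigma>(2)] 2 by simp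
  next
    case 3
    have eq: "c \<rho> = c' \<rho>" if "\<rho> \<in> elts \<tau>" for \<rho>
      using mem.IH[OF that] Ord_trans ord mem.prems that by blast
    show ?thesis
      unfolding computationD(5)[OF c mem.prems(1) 3] computationD(5)[OF c' mem.prems(2) 3]
      using eq by (auto intro!: nat_liminf_cong ord_liminf_cong ext)
  qed
qed

text \<open>If one halting time preceded the other, the longer computation would have left the
  program before its end.\<close>

lemma halts_with_unique:
  assumes "halts_with \<alpha> P x ins v" "halts_with \<alpha> P x ins w"
  shows "v = (w :: 'v::zf)"
proof -
  obtain \<theta> c where c: "computation \<alpha> P x ins \<theta> c" "length P \<le> fst (c \<theta>)" "snd (c \<theta>) 0 = v"
    using assms(1) unfolding halts_with_def by blast
  obtain \<theta>' c' where c': "computation \<alpha> P x ins \<theta>' c'" "length P \<le> fst (c' \<theta>')" "snd (c' \<theta>') 0 = w"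
    using assms(2) unfolding halts_with_def by blast
  have eq: "c \<tau> = c' \<tau>" if "\<tau> \<in> elts (succ \<theta>)" "\<tau> \<in> elts (succ \<theta>')" for \<tau>
    using computation_unique[OF c(1) c'(1)] that by blast
  have "\<theta> \<notin> elts \<theta>'"
    using eq[of \<theta>] computationD(3)[OF c'(1), of \<theta>] c(2) by auto
  moreover have "\<theta>' \<notin> elts \<theta>"
    using eq[of \<theta>'] computationD(3)[OF c(1), of \<theta>'] c'(2) by auto
  ultimately have "\<theta> = \<theta>'"
    using Ord_linear computationD(1)[OF c(1)] computationD(1)[OF c'(1)] by blast
  then show ?thesis using eq[of \<theta>] c(3) c'(3) by simp
qed

lemma step_oracle_cong:
  assumes "\<And>i. snd C i \<in> A" "elts y \<inter> A = elts y' \<inter> A"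
  shows "step P y C = step P y' C"
proof -
  obtain l R where C: "C = (l, R)" by force
  have "R i \<in> elts y \<longleftrightarrow> R i \<in> elts y'" for i using assms C by auto
  then show ?thesis unfolding C by (auto split: instr.split)
qed

text \<open>Only register contents are queried, and these lie below \<open>b\<close>; hence oracles
  agreeing below \<open>b\<close> cannot be told apart. Raising the bound to \<open>\<alpha>\<close>
  only weakens the overflow condition.\<close>

lemma computation_transfer:
  assumes c: "computation b P y ins \<theta> c" and "elts b \<subseteq> elts \<alpha>"
    and "elts y \<inter> elts b = elts y' \<inter> elts b"
  shows "computation \<alpha> P y' ins \<theta> c"
proof -
  have "step P y (c \<tau>) = step P y' (c \<tau>)" if "\<tau> \<in> elts \<theta>" for \<tau>
    using computationD(6)[OF c, of \<tau>] that assms(3) by (intro step_oracle_cong[of _ "elts b"]) auto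
  then show ?thesis using c assms(2) unfolding computation_def by auto
qed

section \<open>Configurations and single steps in terms of finite lists of sets\<close>

definition code :: "nat \<times> (nat \<Rightarrow> 'v::zf) \<Rightarrow> nat \<Rightarrow> 'v" where
  "code C = case_nat (num (fst C)) (snd C)"

lemma code_simps [simp]: "code C 0 = num (fst C)" "code C (Suc i) = snd C i"
  by (simp_all add: code_def)

fun regs :: "instr \<Rightarrow> nat set" where
  "regs (Inc i) = {i}"
| "regs (Copy i j) = {i, j}"
| "regs (Jump i j k) = {i, j}"
| "regs (Oracle i) = {i}"

text \<open>Register \<open>r\<close> is component \<open>Suc r\<close> of a code, behind the line
  index. The condition \<open>1 < n\<close> ensures that register 0, used for input and output, is
  recorded.\<close>

definition fits :: "prog \<Rightarrow> nat \<Rightarrow> bool" where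
  "fits P n \<longleftrightarrow> 1 < n \<and> (\<forall>l<length P. \<forall>r\<in>regs (P ! l). Suc r < n)"

lemma fits_exists: "\<exists>n. fits P n"
proof -
  have "finite (regs I)" for I by (cases I) auto
  then have "finite (\<Union>l<length P. regs (P ! l))" by blast
  then obtain m where m: "\<forall>r\<in>(\<Union>l<length P. regs (P ! l)). r < m"
    using finite_nat_set_iff_bounded by blast
  have "fits P (m + 2)" unfolding fits_def using m by fastforce
  then show ?thesis by blast
qed

lemma config_eqI:
  assumes "0 < n" "\<And>i. i < n \<Longrightarrow> code C i = code D i" "\<And>i. n \<le> Suc i \<Longrightarrow> snd C i = snd D i"
  shows "C = (D :: nat \<times> (nat \<Rightarrow> 'v::zf))"
proof (rule prod_eqI)
  show "fst C = fst D" using assms(2)[of 0] assms(1) by simp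
  have "snd C i = snd D i" for i using assms(2)[of "Suc i"] assms(3)[of i] by (cases "Suc i < n") auto
  then show "snd C = snd D" by blast
qed

lemma step_outside:
  assumes "fits P n" "fst C < length P" "n \<le> Suc i"
  shows "snd (step P y C) i = snd C i"
proof -
  obtain l R where C: "C = (l, R)" by force
  have "\<forall>r\<in>regs (P ! l). Suc r < n" using assms(1,2) unfolding fits_def C by simp
  then show ?thesis unfolding C using assms(3) by (cases "P ! l") auto
qed

text \<open>A single step as a relation between codes, built from conditions with evident bounded
  definitions.\<close>

fun instr_ok :: "nat \<Rightarrow> 'v::zf \<Rightarrow> 'v list \<Rightarrow> 'v list \<Rightarrow> nat \<Rightarrow> instr \<Rightarrow> bool" where
  "instr_ok n y vs ws l (Inc j) \<longleftrightarrow>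
     ws ! 0 = num (Suc l) \<and> ws ! Suc j = succ (vs ! Suc j) \<and>
     (\<forall>i<n. i \<noteq> 0 \<longrightarrow> i \<noteq> Suc j \<longrightarrow> ws ! i = vs ! i)"
| "instr_ok n y vs ws l (Copy k j) \<longleftrightarrow>
     ws ! 0 = num (Suc l) \<and> ws ! Suc j = vs ! Suc k \<and>
     (\<forall>i<n. i \<noteq> 0 \<longrightarrow> i \<noteq> Suc j \<longrightarrow> ws ! i = vs ! i)"
| "instr_ok n y vs ws l (Jump j k l') \<longleftrightarrow>
     (vs ! Suc j = vs ! Suc k \<longrightarrow> ws ! 0 = num l') \<and>
     (vs ! Suc j \<noteq> vs ! Suc k \<longrightarrow> ws ! 0 = num (Suc l)) \<and>
     (\<forall>i<n. i \<noteq> 0 \<longrightarrow> ws ! i = vs ! i)"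
| "instr_ok n y vs ws l (Oracle j) \<longleftrightarrow>
     ws ! 0 = num (Suc l) \<and>
     (vs ! Suc j \<in> elts y \<longrightarrow> ws ! Suc j = num 1) \<and>
     (vs ! Suc j \<notin> elts y \<longrightarrow> ws ! Suc j = num 0) \<and>
     (\<forall>i<n. i \<noteq> 0 \<longrightarrow> i \<noteq> Suc j \<longrightarrow> ws ! i = vs ! i)"

definition next_ok :: "prog \<Rightarrow> nat \<Rightarrow> 'v::zf \<Rightarrow> 'v list \<Rightarrow> 'v list \<Rightarrow> bool" where
  "next_ok P n y vs ws \<longleftrightarrow> (\<exists>l<length P. vs ! 0 = num l \<and> instr_ok n y vs ws l (P ! l))"

lemma next_ok_iff:
  assumes "fits P n" "fst C < length P"
  shows "next_ok P n y (map (code C) [0..<n]) ws \<longleftrightarrow> (\<forall>i<n. ws ! i = code (step P y C) i)"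
proof -
  obtain l R where C: "C = (l, R)" by force
  have l: "l < length P" and n: "0 < n" and r: "\<forall>r\<in>regs (P ! l). Suc r < n"
    using assms unfolding fits_def C by auto
  have "next_ok P n y (map (code C) [0..<n]) ws \<longleftrightarrow>
      instr_ok n y (map (code C) [0..<n]) ws l (P ! l)"
    unfolding next_ok_def C using l n by auto
  also have "\<dots> \<longleftrightarrow> (\<forall>i<n. ws ! i = code (step P y C) i)"
  proof -
    \<comment> \<open>Isolates the line index and the one register that the instruction may
      change.\<close>
    have split: "(\<forall>i<n. ws ! i = code D i) \<longleftrightarrow>
        ws ! 0 = num (fst D) \<and> (Suc j < n \<longrightarrow> ws ! Suc j = snd D j) \<and>
        (\<forall>i<n. i \<noteq> 0 \<longrightarrow> i \<noteq> Suc j \<longrightarrow> ws ! i = code D i)" for D j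
      using n by (metis code_simps)
    have split0: "(\<forall>i<n. ws ! i = code D i) \<longleftrightarrow>
        ws ! 0 = num (fst D) \<and> (\<forall>i<n. i \<noteq> 0 \<longrightarrow> ws ! i = code D i)" for D
      using n by (metis code_simps(1))
    have upd: "code (l', R(j := v)) i = code (l, R) i" if "i \<noteq> 0" "i \<noteq> Suc j" for l' j v i
      using that by (cases i) auto
    have code0: "code (l', R) i = code (l, R) i" if "i \<noteq> 0" for l' i
      using that by (cases i) auto
    show ?thesis
    proof (cases "P ! l")
      case (Inc j)
      then show ?thesis unfolding C split[of _ j] using r n by (simp add: upd del: upt_Suc)
    next
      case (Copy k j)
      then show ?thesis unfolding C split[of _ j] using r n by (simp add: upd del: upt_Suc)
    next
      case (Jump j k l')
      then show ?thesis
        unfolding C split0 using r n code0[of _ l'] code0[of _ "Suc l"] by (simp del: upt_Suc)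
    next
      case (Oracle j)
      then show ?thesis unfolding C split[of _ j] using r n by (simp add: upd del: upt_Suc)
    qed
  qed
  finally show ?thesis .
qed

lemma D0_instr_ok:
  assumes "0 < n" "\<forall>r\<in>regs I. Suc r < n"
  shows "D0 (\<lambda>s. instr_ok n (s y) (map (\<lambda>i. s (f i)) [0..<n]) (map (\<lambda>i. s (g i)) [0..<n]) l I)"
  using assms
  by (cases I)
     (simp_all del: num.simps,
      (intro D0_all_less D0_intros D0_const D0_is_num D0_is_succ; simp add: D0_eq)+)

lemma D0_next_ok:
  assumes "fits P n"
  shows "D0 (\<lambda>s. next_ok P n (s y) (map (\<lambda>i. s (f i)) [0..<n]) (map (\<lambda>i. s (g i)) [0..<n]))"
proof -
  have "D0 (\<lambda>s. \<exists>l<length P. s (f 0) = num l \<and>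
      instr_ok n (s y) (map (\<lambda>i. s (f i)) [0..<n]) (map (\<lambda>i. s (g i)) [0..<n]) l (P ! l))"
    using assms unfolding fits_def
    by (intro D0_ex_less D0_conj D0_is_num D0_instr_ok) auto
  then show ?thesis using assms by (simp add: next_ok_def fits_def)
qed

section \<open>Certificates of computations\<close>

text \<open>The sets \<open>gs ! i\<close> are meant to contain the graphs of the components of the codes of the
  configurations; \<open>snapshot\<close> says that \<open>vs\<close> is the code of the configuration at time \<open>\<tau>\<close> and is
  obtained from the earlier ones as in a computation. All values are bounded by \<open>b\<close>. The line
  indices have their own bound \<open>K\<close>, since a halting computation may jump beyond the last line.\<close>

definition snapshot ::
    "prog \<Rightarrow> nat \<Rightarrow> nat \<Rightarrow> 'v::zf \<Rightarrow> 'v \<Rightarrow> 'v \<Rightarrow> 'v list \<Rightarrow> 'v \<Rightarrow> 'v list \<Rightarrow> bool" where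
  "snapshot P n K b y \<xi> gs \<tau> vs \<longleftrightarrow>
     (\<forall>i<n. \<forall>v\<in>elts b. opair \<tau> v \<in> elts (gs ! i) \<longleftrightarrow> v = vs ! i) \<and>
     (\<exists>l<K. vs ! 0 = num l) \<and>
     (\<tau> = zero \<longrightarrow> (\<forall>i<n. (i = 1 \<longrightarrow> vs ! i = \<xi>) \<and> (i \<noteq> 1 \<longrightarrow> vs ! i = zero))) \<and>
     (\<forall>\<sigma>\<in>elts \<tau>. \<tau> = succ \<sigma> \<longrightarrow>
        (\<exists>us. length us = n \<and> set us \<subseteq> elts b \<and>
           ((\<forall>i<n. opair \<sigma> (us ! i) \<in> elts (gs ! i)) \<and> next_ok P n y us vs))) \<and>
     (Limit \<tau> \<longrightarrow> (\<forall>i<n. \<forall>z\<in>elts b. z \<in> elts (vs ! i) \<longleftrightarrow>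
        (\<exists>\<sigma>\<in>elts \<tau>. \<forall>\<upsilon>\<in>elts \<tau>. elts \<sigma> \<subseteq> elts \<upsilon> \<longrightarrow>
           (\<exists>u\<in>elts b. opair \<upsilon> u \<in> elts (gs ! i) \<and> z \<in> elts u))))"

text \<open>The length \<open>\<rho>\<close> is an exclusive bound: a computation up to and
  including \<open>\<theta>\<close> corresponds to length \<open>succ \<theta>\<close>.\<close>

definition cert ::
    "prog \<Rightarrow> nat \<Rightarrow> nat \<Rightarrow> 'v::zf \<Rightarrow> 'v \<Rightarrow> 'v \<Rightarrow> 'v \<Rightarrow> 'v list \<Rightarrow> bool" where
  "cert P n K b y \<xi> \<rho> gs \<longleftrightarrow> Ord b \<and> Ord \<rho> \<and>
     (\<forall>\<tau>\<in>elts \<rho>. \<exists>vs. length vs = n \<and> set vs \<subseteq> elts b \<and> snapshot P n K b y \<xi> gs \<tau> vs)"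

text \<open>Each quantifier in a certificate is bounded by a given set or ranges over finitely many
  numbers of the metalevel.\<close>

lemma D0_cert:
  assumes "fits P n"
  shows "D0 (\<lambda>s. cert P n K (s b) (s y) (s x) (s r) (map (\<lambda>i. s (g i)) [0..<n]))"
proof -
  have n: "0 < n" using assms by (simp add: fits_def)
  show ?thesis
    unfolding cert_def snapshot_def using n
    by (intro D0_conj D0_Ord D0_ball D0_ex_list D0_imp D0_bex D0_next_ok D0_all_less D0_ex_less
        D0_is_zero D0_is_succ D0_Limit D0_iff D0_not D0_const D0_subset assms)
       (simp_all add: D0_eq D0_mem D0_is_num D0_is_zero D0_opair_mem del: upt_Suc)
qed

section \<open>From certificates to computations\<close>

text \<open>The configurations are read off from the snapshots; the clauses for zero, successors and
  limits then become those of a computation.\<close>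

lemma cert_sound:
  assumes fits: "fits P n" and cert: "cert P n K b y \<xi> (succ \<theta>) gs"
  obtains c where "computation b P y [\<xi>] \<theta> c"
    "\<And>\<tau> i v. \<tau> \<in> elts (succ \<theta>) \<Longrightarrow> i < n \<Longrightarrow> v \<in> elts b \<Longrightarrow>
       opair \<tau> v \<in> elts (gs ! i) \<longleftrightarrow> v = code (c \<tau>) i"
proof -
  have n: "1 < n" using fits by (simp add: fits_def)
  have b: "Ord b" and \<theta>: "Ord \<theta>" using cert by (simp_all add: cert_def)
  obtain V where V_ok: "\<And>\<tau>. \<tau> \<in> elts (succ \<theta>) \<Longrightarrow>
      length (V \<tau>) = n \<and> set (V \<tau>) \<subseteq> elts b \<and> snapshot P n K b y \<xi> gs \<tau> (V \<tau>)"
    using cert unfolding cert_def by metis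
  have len: "length (V \<tau>) = n" and in_b: "set (V \<tau>) \<subseteq> elts b" and line: "\<exists>l. V \<tau> ! 0 = num l"
    if "\<tau> \<in> elts (succ \<theta>)" for \<tau>
    using V_ok[OF that] unfolding snapshot_def by blast+
  have graph: "opair \<tau> v \<in> elts (gs ! i) \<longleftrightarrow> v = V \<tau> ! i"
    if "\<tau> \<in> elts (succ \<theta>)" "i < n" "v \<in> elts b" for \<tau> i v
    using V_ok[OF that(1)] that(2,3) unfolding snapshot_def by blast
  have init: "V zero ! i = (if i = 1 then \<xi> else zero)" if "zero \<in> elts (succ \<theta>)" "i < n" for i
    using V_ok[OF that(1)] that(2) unfolding snapshot_def by simp
  have next_ex: "\<exists>us. length us = n \<and> set us \<subseteq> elts b \<and>
      (\<forall>i<n. opair \<sigma> (us ! i) \<in> elts (gs ! i)) \<and> next_ok P n y us (V (succ \<sigma>))"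
    if "succ \<sigma> \<in> elts (succ \<theta>)" for \<sigma>
    using V_ok[OF that] unfolding snapshot_def elts_succ by blast
  have lim: "z \<in> elts (V \<tau> ! i) \<longleftrightarrow> (\<exists>\<sigma>\<in>elts \<tau>. \<forall>\<upsilon>\<in>elts \<tau>. elts \<sigma> \<subseteq> elts \<upsilon> \<longrightarrow>
      (\<exists>u\<in>elts b. opair \<upsilon> u \<in> elts (gs ! i) \<and> z \<in> elts u))"
    if "\<tau> \<in> elts (succ \<theta>)" "Limit \<tau>" "i < n" "z \<in> elts b" for \<tau> i z
    using V_ok[OF that(1)] that(2-) unfolding snapshot_def by blast
  obtain L where L: "\<And>\<tau>. \<tau> \<in> elts (succ \<theta>) \<Longrightarrow> V \<tau> ! 0 = num (L \<tau>)" using line by metis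
  \<comment> \<open>Registers that are not recorded lie outside the program and behind the input, so
    they keep the value 0.\<close>
  define c where "c = (\<lambda>\<tau>. (L \<tau>, \<lambda>i. if Suc i < n then V \<tau> ! Suc i else zero))"
  have code: "code (c \<tau>) i = V \<tau> ! i" if "\<tau> \<in> elts (succ \<theta>)" "i < n" for \<tau> i
    using that L by (cases i) (auto simp: c_def)
  have V: "V \<tau> = map (code (c \<tau>)) [0..<n]" if "\<tau> \<in> elts (succ \<theta>)" for \<tau>
    using code that len by (intro nth_equalityI) auto
  have code_b: "code (c \<tau>) i \<in> elts b" if "\<tau> \<in> elts (succ \<theta>)" "i < n" for \<tau> i
    using in_b[OF that(1)] that by (auto simp: V)
  have tr: "\<tau> \<in> elts (succ \<theta>)" if "\<mu> \<in> elts (succ \<theta>)" "\<tau> \<in> elts \<mu>" for \<tau> \<mu>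
    using Ord_trans[of "succ \<theta>"] \<theta> that by auto
  have snd_outside: "snd (c \<tau>) i = zero" if "n \<le> Suc i" for \<tau> i
    using that by (simp add: c_def)
  have zero: "zero \<in> elts (succ \<theta>)"
    using zero_in_Ord[of "succ \<theta>" \<theta>] \<theta> by simp
  have zero_b: "zero \<in> elts b"
    using zero_in_Ord[OF b code_b[OF zero, of 0]] n by simp
  have step_ok: "fst (c \<tau>) < length P \<and> c (succ \<tau>) = step P y (c \<tau>)" if "\<tau> \<in> elts \<theta>" for \<tau>
  proof -
    have \<tau>: "\<tau> \<in> elts (succ \<theta>)" "succ \<tau> \<in> elts (succ \<theta>)"
      using that succ_mem_succ[OF \<theta>] by simp_all
    obtain us where us: "length us = n" "set us \<subseteq> elts b"
      "\<forall>i<n. opair \<tau> (us ! i) \<in> elts (gs ! i)" "next_ok P n y us (V (succ \<tau>))"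
      using next_ex[OF \<tau>(2)] by blast
    \<comment> \<open>Below \<open>b\<close> the graphs are single-valued, so that the predecessor
      claimed by the certificate is the recorded one.\<close>
    have "us ! i = V \<tau> ! i" if "i < n" for i
    proof -
      have "us ! i \<in> elts b" using us(1,2) that nth_mem by blast
      then show ?thesis using graph[OF \<tau>(1) that] us(3) that by blast
    qed
    then have us_eq: "us = map (code (c \<tau>)) [0..<n]"
      using us(1) code[OF \<tau>(1)] by (intro nth_equalityI) auto
    then have "fst (c \<tau>) < length P" using us(4) n by (auto simp: next_ok_def)
    moreover have "c (succ \<tau>) = step P y (c \<tau>)"
    proof (rule config_eqI[of n])
      show "code (c (succ \<tau>)) i = code (step P y (c \<tau>)) i" if "i < n" for i
        using us(4) next_ok_iff[OF fits calculation] that code[OF \<tau>(2)] unfolding us_eq by simp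
      show "snd (c (succ \<tau>)) i = snd (step P y (c \<tau>)) i" if "n \<le> Suc i" for i
        using step_outside[OF fits calculation that] snd_outside that by simp
    qed (use n in simp)
    ultimately show ?thesis by blast
  qed
  have lim_ok: "c \<mu> = (nat_liminf \<mu> (\<lambda>\<tau>. fst (c \<tau>)), \<lambda>i. ord_liminf \<mu> (\<lambda>\<tau>. snd (c \<tau>) i))"
    if \<mu>: "\<mu> \<in> elts (succ \<theta>)" "Limit \<mu>" for \<mu>
  proof (rule config_eqI[of n])
    have line_less: "fst (c \<tau>) < length P" if "\<tau> \<in> elts \<mu>" for \<tau>
      using \<mu>(1) that Ord_trans[OF \<theta>] step_ok by auto
    fix i assume i: "i < n"
    have "code (c \<mu>) i = ord_liminf \<mu> (\<lambda>\<tau>. code (c \<tau>) i)"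
    proof (rule extensionality, rule set_eqI)
      fix z
      have graph': "(\<exists>u\<in>elts b. opair \<tau> u \<in> elts (gs ! i) \<and> z \<in> elts u) \<longleftrightarrow> z \<in> elts (code (c \<tau>) i)"
        if "\<tau> \<in> elts \<mu>" for \<tau>
        using graph[OF tr[OF \<mu>(1) that] i] code_b[OF tr[OF \<mu>(1) that] i] code[OF tr[OF \<mu>(1) that] i]
        by auto
      show "z \<in> elts (code (c \<mu>) i) \<longleftrightarrow> z \<in> elts (ord_liminf \<mu> (\<lambda>\<tau>. code (c \<tau>) i))"
      proof (cases "z \<in> elts b")
        case True
        then show ?thesis
          by (simp add: mem_ord_liminf code[OF \<mu>(1) i] lim[OF \<mu> i True] graph'
              cong: ball_cong bex_cong)
      next
        case False
        \<comment> \<open>All values are elements of the ordinal \<open>b\<close> and hence subsets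
          of it, so that both sides are false.\<close>
        have "z \<notin> elts (code (c \<tau>) i)" if "\<tau> \<in> elts (succ \<theta>)" for \<tau>
          using code_b[OF that i] Ord_trans[OF b] False by blast
        then show ?thesis unfolding mem_ord_liminf using \<mu>(1) tr[OF \<mu>(1)] by blast
      qed
    qed
    then show "code (c \<mu>) i = code (nat_liminf \<mu> (\<lambda>\<tau>. fst (c \<tau>)),
        \<lambda>i. ord_liminf \<mu> (\<lambda>\<tau>. snd (c \<tau>) i)) i"
      using ord_liminf_num[OF Limit_not_zero[OF \<mu>(2)] line_less] by (cases i) auto
  next
    fix i assume "n \<le> Suc i"
    then show "snd (c \<mu>) i = snd (nat_liminf \<mu> (\<lambda>\<tau>. fst (c \<tau>)),
        \<lambda>i. ord_liminf \<mu> (\<lambda>\<tau>. snd (c \<tau>) i)) i"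
      by (simp add: snd_outside ord_liminf_zero)
  qed (use n in simp)
  have "c zero = initial [\<xi>]"
  proof (rule config_eqI[of n])
    show "code (c zero) i = code (initial [\<xi>]) i" if "i < n" for i
      using code[OF zero that] init[OF zero that] by (cases i) (auto simp: initial_def)
    show "snd (c zero) i = snd (initial [\<xi>]) i" if "n \<le> Suc i" for i
      using n that by (simp add: snd_outside initial_def)
  qed (use n in simp)
  moreover have "snd (c \<tau>) i \<in> elts b" if "\<tau> \<in> elts (succ \<theta>)" for \<tau> i
    using code_b[OF that, of "Suc i"] snd_outside[of i \<tau>] zero_b by (cases "Suc i < n") auto
  ultimately have "computation b P y [\<xi>] \<theta> c"
    unfolding computation_def using \<theta> step_ok lim_ok by blast
  then show thesis using that graph code by metis
qed

section \<open>From computations to constructible certificates\<close>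

definition graph :: "('v::zf \<Rightarrow> nat \<times> (nat \<Rightarrow> 'v)) \<Rightarrow> nat \<Rightarrow> 'v \<Rightarrow> 'v" where
  "graph c i \<rho> = set_of ((\<lambda>\<tau>. opair \<tau> (code (c \<tau>) i)) ` elts \<rho>)"

lemma elts_graph: "elts (graph c i \<rho>) = (\<lambda>\<tau>. opair \<tau> (code (c \<tau>) i)) ` elts \<rho>"
  unfolding graph_def by (rule elts_image)

text \<open>The one ordinal \<open>b\<close> bounds both the register contents and the codes of line
  indices.\<close>

locale bounded_computation =
  fixes \<alpha> y \<xi> \<theta> b :: "'v::zf" and P :: prog and c :: "'v \<Rightarrow> nat \<times> (nat \<Rightarrow> 'v)" and n K :: nat
  assumes comp: "computation \<alpha> P y [\<xi>] \<theta> c" and fits: "fits P n"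
    and Ord_b: "Ord b" and \<alpha>_le: "elts \<alpha> \<subseteq> elts b"
    and line_less: "\<And>\<tau>. \<tau> \<in> elts (succ \<theta>) \<Longrightarrow> fst (c \<tau>) < K"
    and num_in_b: "\<And>l. l < K \<Longrightarrow> num l \<in> elts b"
begin

lemma code_in_b: "\<tau> \<in> elts (succ \<theta>) \<Longrightarrow> code (c \<tau>) i \<in> elts b"
  using line_less num_in_b computationD(6)[OF comp] \<alpha>_le by (cases i) auto

lemma code_Limit:
  assumes \<mu>: "\<mu> \<in> elts (succ \<theta>)" "Limit \<mu>"
  shows "code (c \<mu>) i = ord_liminf \<mu> (\<lambda>\<tau>. code (c \<tau>) i)"
proof (cases i)
  case 0
  have "fst (c \<tau>) < K" if "\<tau> \<in> elts \<mu>" for \<tau>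
    using line_less Ord_trans[of "succ \<theta>" \<mu> \<tau>] computationD(1)[OF comp] \<mu>(1) that by simp
  then have "ord_liminf \<mu> (\<lambda>\<tau>. num (fst (c \<tau>))) = num (nat_liminf \<mu> (\<lambda>\<tau>. fst (c \<tau>)))"
    by (rule ord_liminf_num[OF Limit_not_zero[OF \<mu>(2)]])
  then show ?thesis using 0 computationD(5)[OF comp \<mu>] by simp
next
  case (Suc j)
  then show ?thesis using computationD(5)[OF comp \<mu>] by simp
qed

text \<open>Stated for all initial segments of the computation, since the limit case of
  \<open>graph_constructible\<close> uses certificates of shorter ones.\<close>

lemma cert_graphs:
  assumes \<rho>: "Ord \<rho>" "elts \<rho> \<subseteq> elts (succ \<theta>)"
  shows "cert P n K b y \<xi> \<rho> (map (\<lambda>i. graph c i \<rho>) [0..<n])"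
proof -
  let ?gs = "map (\<lambda>i. graph c i \<rho>) [0..<n]"
  have gs: "opair \<tau> v \<in> elts (?gs ! i) \<longleftrightarrow> \<tau> \<in> elts \<rho> \<and> v = code (c \<tau>) i" if "i < n" for \<tau> v i
    using that by (auto simp: elts_graph)
  have n: "1 < n" using fits by (simp add: fits_def)
  have "snapshot P n K b y \<xi> ?gs \<tau> (map (code (c \<tau>)) [0..<n]) \<and> set (map (code (c \<tau>)) [0..<n]) \<subseteq> elts b"
    if \<tau>: "\<tau> \<in> elts \<rho>" for \<tau>
  proof -
    have \<tau>': "\<tau> \<in> elts (succ \<theta>)" using \<tau> \<rho>(2) by blast
    have tr: "\<sigma> \<in> elts \<rho>" "\<sigma> \<in> elts (succ \<theta>)" if "\<sigma> \<in> elts \<tau>" for \<sigma>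
      using Ord_trans[OF \<rho>(1) \<tau>] \<rho>(2) that by blast+
    show ?thesis
      unfolding snapshot_def
    proof (intro conjI allI impI ballI)
      show "set (map (code (c \<tau>)) [0..<n]) \<subseteq> elts b" using code_in_b[OF \<tau>'] by auto
      show "opair \<tau> v \<in> elts (?gs ! i) \<longleftrightarrow> v = map (code (c \<tau>)) [0..<n] ! i" if "i < n" for i v
        using gs[OF that] \<tau> that by simp
      show "\<exists>l<K. map (code (c \<tau>)) [0..<n] ! 0 = num l" using line_less[OF \<tau>'] n by auto
    next
      fix i assume "\<tau> = zero" "i < n" "i = 1"
      then show "map (code (c \<tau>)) [0..<n] ! i = \<xi>"
        using computationD(2)[OF comp] by (simp add: initial_def)
    next
      fix i assume "\<tau> = zero" "i < n" "i \<noteq> 1"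
      then show "map (code (c \<tau>)) [0..<n] ! i = zero"
        using computationD(2)[OF comp] by (cases i) (auto simp: initial_def)
    next
      fix \<sigma> assume \<sigma>: "\<sigma> \<in> elts \<tau>" "\<tau> = succ \<sigma>"
      then have \<sigma>\<theta>: "\<sigma> \<in> elts \<theta>" using \<tau>' succ_mem_succ[OF computationD(1)[OF comp]] by blast
      show "\<exists>us. length us = n \<and> set us \<subseteq> elts b \<and>
          ((\<forall>i<n. opair \<sigma> (us ! i) \<in> elts (?gs ! i)) \<and> next_ok P n y us (map (code (c \<tau>)) [0..<n]))"
      proof (intro exI[of _ "map (code (c \<sigma>)) [0..<n]"] conjI allI impI)
        show "set (map (code (c \<sigma>)) [0..<n]) \<subseteq> elts b" using code_in_b[OF tr(2)[OF \<sigma>(1)]] by auto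
        show "opair \<sigma> (map (code (c \<sigma>)) [0..<n] ! i) \<in> elts (?gs ! i)" if "i < n" for i
          using gs[OF that] tr(1)[OF \<sigma>(1)] that by simp
        show "next_ok P n y (map (code (c \<sigma>)) [0..<n]) (map (code (c \<tau>)) [0..<n])"
          using next_ok_iff[OF fits computationD(3)[OF comp \<sigma>\<theta>]] computationD(4)[OF comp \<sigma>\<theta>] \<sigma>(2)
          by simp
      qed simp
    next
      fix i z assume "Limit \<tau>" and i: "i < n"
      have "(\<exists>u\<in>elts b. opair \<upsilon> u \<in> elts (?gs ! i) \<and> z \<in> elts u) \<longleftrightarrow> z \<in> elts (code (c \<upsilon>) i)"
        if "\<upsilon> \<in> elts \<tau>" for \<upsilon>
        unfolding gs[OF i] using tr[OF that] code_in_b by blast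
      then show "z \<in> elts (map (code (c \<tau>)) [0..<n] ! i) \<longleftrightarrow>
          (\<exists>\<sigma>\<in>elts \<tau>. \<forall>\<upsilon>\<in>elts \<tau>. elts \<sigma> \<subseteq> elts \<upsilon> \<longrightarrow>
             (\<exists>u\<in>elts b. opair \<upsilon> u \<in> elts (?gs ! i) \<and> z \<in> elts u))"
        using code_Limit[OF \<tau>' \<open>Limit \<tau>\<close>, of i] i by (simp add: mem_ord_liminf cong: ball_cong bex_cong)
    qed
  qed
  then have "\<exists>vs. length vs = n \<and> set vs \<subseteq> elts b \<and> snapshot P n K b y \<xi> ?gs \<tau> vs"
    if "\<tau> \<in> elts \<rho>" for \<tau>
    using that by (intro exI[of _ "map (code (c \<tau>)) [0..<n]"]) auto
  then show ?thesis unfolding cert_def using Ord_b \<rho>(1) by blast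
qed

text \<open>Induction on the length. A successor adds one pair. At a limit the shorter graphs lie in
  a common level of \<open>L\<close>, and bounded separation collects the pairs that occur in
  certificates from that level.\<close>

lemma graph_constructible:
  assumes y: "y \<in> constructible" and \<xi>: "\<xi> \<in> constructible"
    and \<rho>: "Ord \<rho>" "elts \<rho> \<subseteq> elts (succ \<theta>)"
  shows "\<forall>i<n. graph c i \<rho> \<in> constructible"
  using \<rho>
proof (induction \<rho> rule: mem_induct)
  case (mem \<rho>)
  note \<rho> = mem.prems
  have code_L: "code (c \<tau>) i \<in> constructible" if "\<tau> \<in> elts (succ \<theta>)" for \<tau> i
    using code_in_b[OF that] Ord_in_Ord[OF Ord_b] Ord_constructible by blast
  show ?case
    using \<rho>(1)
  proof (cases rule: Ord_cases)
    case 1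
    then have "graph c i \<rho> = zero" for i by (simp add: elts_eq_iff[of "graph _ _ _"] elts_graph)
    then show ?thesis using Ord_constructible[OF Ord_zero, where 'v = 'v] by simp
  next
    case (2 \<sigma>)
    then have \<sigma>: "\<sigma> \<in> elts (succ \<theta>)" "elts \<sigma> \<subseteq> elts (succ \<theta>)" using \<rho>(2) by auto
    have "graph c i \<rho> = set_of (insert (opair \<sigma> (code (c \<sigma>) i)) (elts (graph c i \<sigma>)))" for i
      unfolding elts_graph using 2 by (simp add: graph_def)
    moreover have "graph c i \<sigma> \<in> constructible" if "i < n" for i
      using mem.IH[of \<sigma>] 2 \<sigma> that by simp
    moreover have "opair \<sigma> (code (c \<sigma>) i) \<in> constructible" for i
      using code_L[OF \<sigma>(1)] Ord_constructible[OF 2(1)] by (intro opair_constructible)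
    ultimately show ?thesis using insert_constructible by metis
  next
    case 3
    have \<sigma>: "Ord \<sigma>" "elts \<sigma> \<subseteq> elts \<rho>" "succ \<sigma> \<in> elts \<rho>" if "\<sigma> \<in> elts \<rho>" for \<sigma>
      using Ord_in_Ord[OF \<rho>(1) that] Ord_trans[OF \<rho>(1) that] 3 that by (auto simp: Limit_def)
    have IH: "graph c i \<sigma> \<in> constructible" if "\<sigma> \<in> elts \<rho>" "i < n" for i \<sigma>
      using mem.IH[OF that(1)] \<sigma>[OF that(1)] \<rho>(2) that by blast
    \<comment> \<open>\<open>A\<close> is a level of \<open>L\<close> containing all shorter graphs
      and, by transitivity, their pairs.\<close>
    obtain A where A: "A \<in> constructible"
      and graph_A: "\<And>\<sigma> i. \<sigma> \<in> elts \<rho> \<Longrightarrow> i < n \<Longrightarrow> graph c i \<sigma> \<in> elts A"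
      and A_trans: "\<And>x z. x \<in> elts A \<Longrightarrow> z \<in> elts x \<Longrightarrow> z \<in> elts A"
    proof -
      have "\<exists>F :: 'v. elts F = (\<lambda>i. graph c i \<sigma>) ` {..<n}" for \<sigma>
        by (rule finite_is_set) simp
      then obtain F where F: "\<And>\<sigma>. elts (F \<sigma> :: 'v) = (\<lambda>i. graph c i \<sigma>) ` {..<n}" by metis
      have "elts (set_of (\<Union>\<sigma>\<in>elts \<rho>. elts (F \<sigma>))) \<subseteq> constructible"
        unfolding elts_UN unfolding F using IH by blast
      then obtain \<gamma> where \<gamma>: "Ord \<gamma>" "elts (set_of (\<Union>\<sigma>\<in>elts \<rho>. elts (F \<sigma>))) \<subseteq> elts (Lset \<gamma>)"
        by (rule constructible_cover)
      show thesis
      proof (rule that[of "Lset \<gamma>"])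
        show "graph c i \<sigma> \<in> elts (Lset \<gamma>)" if "\<sigma> \<in> elts \<rho>" "i < n" for \<sigma> i
          using \<gamma>(2) that unfolding elts_UN unfolding F by blast
      qed (use \<gamma>(1) Lset_constructible Lset_transitive in blast)+
    qed
    define s where "s = (!) [b, y, \<xi>, \<rho>, A]"
    have s: "s 0 = b" "s 1 = y" "s 2 = \<xi>" "s 3 = \<rho>" "s 4 = A" by (simp_all add: s_def)
    show ?thesis
    proof (intro allI impI)
      fix i assume i: "i < n"
      \<comment> \<open>The value at time \<open>\<tau>\<close> is taken from a certificate of
        length \<open>succ \<tau>\<close>, the least length that covers \<open>\<tau>\<close>; it is
        below the limit \<open>\<rho>\<close>.\<close>
      define R where "R = (\<lambda>a (t :: nat \<Rightarrow> 'v). a \<in> elts (t 4) \<and> (\<exists>\<tau>\<in>elts (t 3). \<exists>\<sigma>\<in>elts (t 3). \<sigma> = succ \<tau> \<and>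
          (\<exists>gs. length gs = n \<and> set gs \<subseteq> elts (t 4) \<and>
             (cert P n K (t 0) (t 1) (t 2) \<sigma> gs \<and>
              (\<exists>v\<in>elts (t 0). a = opair \<tau> v \<and> a \<in> elts (gs ! i))))))"
      have D0: "D0 (\<lambda>t. R (t 0) (\<lambda>n. t (Suc n)))"
        unfolding R_def
        by (intro D0_conj D0_mem D0_bex D0_is_succ D0_ex_list D0_cert D0_is_opair fits)
           (use i in \<open>simp add: D0_mem del: upt_Suc\<close>)
      have L: "set_of {a. R a s} \<in> constructible"
      proof (rule constructible_separation[OF D0, where k = 5 and A = A])
        show "R a t \<longleftrightarrow> R a s" if "\<And>n. n < 5 \<Longrightarrow> t n = s n" for a t
          unfolding R_def using that[of 0] that[of 1] that[of 2] that[of 3] that[of 4] by simp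
        show "s n \<in> constructible" if "n < 5" for n
        proof -
          have "n \<in> {0, 1, 2, 3, 4}" using that by auto
          then show ?thesis
            using s A y \<xi> Ord_constructible[OF Ord_b] Ord_constructible[OF \<rho>(1)] by auto
        qed
      qed (use A s in \<open>auto simp: R_def\<close>)
      \<comment> \<open>Certificates of the same length agree, by uniqueness of computations, so that those in \<open>A\<close>
        define the graph.\<close>
      have "{a. R a s} = elts (graph c i \<rho>)"
      proof (intro set_eqI iffI)
        fix a assume "a \<in> {a. R a s}"
        then obtain \<tau> gs v where \<tau>: "\<tau> \<in> elts \<rho>" and cert: "cert P n K b y \<xi> (succ \<tau>) gs"
          and v: "v \<in> elts b" "a = opair \<tau> v" "a \<in> elts (gs ! i)"
          unfolding R_def s by blast
        obtain c' where c': "computation b P y [\<xi>] \<tau> c'"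
          "\<And>\<tau>' i v. \<tau>' \<in> elts (succ \<tau>) \<Longrightarrow> i < n \<Longrightarrow> v \<in> elts b \<Longrightarrow>
             opair \<tau>' v \<in> elts (gs ! i) \<longleftrightarrow> v = code (c' \<tau>') i"
          using cert_sound[OF fits cert] by blast
        have "c \<tau> = c' \<tau>" using \<tau> \<rho>(2) by (intro computation_unique[OF comp c'(1)]) auto
        then have "a = opair \<tau> (code (c \<tau>) i)" using c'(2)[of \<tau> i v] v i by simp
        then show "a \<in> elts (graph c i \<rho>)" using \<tau> by (simp add: elts_graph)
      next
        fix a assume "a \<in> elts (graph c i \<rho>)"
        then obtain \<tau> where \<tau>: "\<tau> \<in> elts \<rho>" "a = opair \<tau> (code (c \<tau>) i)"
          by (auto simp: elts_graph)
        let ?gs = "map (\<lambda>i. graph c i (succ \<tau>)) [0..<n]"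
        have sub: "elts (succ \<tau>) \<subseteq> elts \<rho>" using \<tau>(1) \<sigma>(2)[OF \<tau>(1)] by simp
        have "cert P n K b y \<xi> (succ \<tau>) ?gs"
          using \<sigma>(1)[OF \<tau>(1)] sub \<rho>(2) by (intro cert_graphs) auto
        moreover have "set ?gs \<subseteq> elts A" using graph_A[OF \<sigma>(3)[OF \<tau>(1)]] by auto
        moreover have a: "a \<in> elts (?gs ! i)" using i \<tau>(2) by (simp add: elts_graph)
        moreover have "code (c \<tau>) i \<in> elts b" using \<tau>(1) \<rho>(2) by (intro code_in_b) auto
        moreover have "a \<in> elts A"
          using A_trans[OF graph_A[OF \<sigma>(3)[OF \<tau>(1)] i]] a i by simp
        ultimately show "a \<in> {a. R a s}"
          unfolding R_def s mem_Collect_eq using \<tau> \<sigma>(3)[OF \<tau>(1)]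
          by (intro conjI bexI[of _ \<tau>] bexI[of _ "succ \<tau>"] exI[of _ ?gs]
              bexI[of _ "code (c \<tau>) i"]) auto
      qed
      then show "graph c i \<rho> \<in> constructible" using L by simp
    qed
  qed
qed

end

section \<open>Reflection of an accepting computation and change of its oracle\<close>

theorem lemma16:
  fixes \<alpha> :: "'v::zf" and K :: "'v set"
  assumes "\<exists>\<beta>. Ord \<beta> \<and> is_sigma \<beta> \<alpha>"
    and "K = UNIV \<or> K = constructible"
  shows "\<not> (\<exists>x\<in>constructible. elts x \<subseteq> elts \<alpha> \<and> wITRM_recognizable K \<alpha> x) \<and>
         \<not> (\<exists>x. lost_melody K \<alpha> x)"
proof -
  have \<alpha>: "Ord \<alpha>" and elem: "Sigma1_elementary (elts (Lset \<alpha>)) constructible"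
    using assms(1) unfolding is_sigma_def by blast+
  have "\<not> wITRM_recognizable K \<alpha> x" if x: "x \<in> constructible" "elts x \<subseteq> elts \<alpha>" for x
  proof
    assume "wITRM_recognizable K \<alpha> x"
    \<comment> \<open>Only constructible oracles will be needed, which settles both choices of
      \<open>K\<close>.\<close>
    then obtain P \<xi> where \<xi>: "\<xi> \<in> elts \<alpha>"
      and rec: "\<And>y. y \<in> constructible \<Longrightarrow> elts y \<subseteq> elts \<alpha> \<Longrightarrow>
        halts_with \<alpha> P y [\<xi>] (if y = x then succ zero else zero)"
      using assms(2) unfolding wITRM_recognizable_def by blast
    obtain \<theta> c where c: "computation \<alpha> P x [\<xi>] \<theta> c" "length P \<le> fst (c \<theta>)" "snd (c \<theta>) 0 = succ zero"
      using rec[OF x] unfolding halts_with_def by auto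
    obtain n where fits: "fits P n" using fits_exists by blast
    have n: "1 < n" using fits by (simp add: fits_def)
    \<comment> \<open>Exceeds all line indices including the final one, as the earlier ones are
      below \<open>length P\<close>.\<close>
    define k where "k = Suc (fst (c \<theta>))"
    \<comment> \<open>The maximum of \<open>\<alpha>\<close> and \<open>num k\<close>.\<close>
    define b where "b = (if elts (num k) \<subseteq> elts \<alpha> then \<alpha> else num k)"
    have b: "Ord b" "elts \<alpha> \<subseteq> elts b" "elts (num k) \<subseteq> elts b"
      using \<alpha> Ord_subset_iff[of \<alpha> "num k"] Ord_subset_iff[of "num k" \<alpha>] Ord_linear[of \<alpha> "num k"]
      by (auto simp: b_def)
    interpret bounded_computation \<alpha> x \<xi> \<theta> b P c n k
    proof
      show "fst (c \<tau>) < k" if "\<tau> \<in> elts (succ \<theta>)" for \<tau>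
        using that c(2) computationD(3)[OF c(1), of \<tau>] by (auto simp: k_def)
      show "num l \<in> elts b" if "l < k" for l using b(3) that by (auto simp: elts_num)
    qed (use c fits b in auto)
    \<comment> \<open>The witness \<open>w\<close> has the bound, the oracle, the length and the
      graphs as elements. At time \<open>\<theta>\<close>, component 0 is a line index outside the
      program and component 1, the output register, is 1.\<close>
    define R where "R = (\<lambda>w p :: 'v. \<exists>b\<in>elts w. \<exists>y\<in>elts w. \<exists>\<rho>\<in>elts w. \<exists>\<theta>\<in>elts \<rho>. \<rho> = succ \<theta> \<and>
        (\<exists>gs. length gs = n \<and> set gs \<subseteq> elts w \<and> (cert P n k b y p \<rho> gs \<and>
          (\<exists>v\<in>elts b. (\<exists>l<k. length P \<le> l \<and> v = num l) \<and> opair \<theta> v \<in> elts (gs ! 0)) \<and>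
          (\<exists>v\<in>elts b. v = num 1 \<and> opair \<theta> v \<in> elts (gs ! 1)))))"
    have D0: "D0 (\<lambda>s. R (s 0) (s 1))"
      unfolding R_def using n
      by (intro D0_conj D0_bex D0_is_succ D0_ex_list D0_cert D0_ex_less D0_const D0_is_num fits)
         (simp_all add: D0_opair_mem del: upt_Suc)
    have \<theta>: "Ord \<theta>" using computationD(1)[OF c(1)] .
    have \<xi>L: "\<xi> \<in> constructible" using Ord_in_Ord[OF \<alpha> \<xi>] by (rule Ord_constructible)
    let ?gs = "map (\<lambda>i. graph c i (succ \<theta>)) [0..<n]"
    have gs: "set ?gs \<subseteq> constructible"
      using graph_constructible[OF x(1) \<xi>L, of "succ \<theta>"] \<theta> by auto
    have "finite ({b, x, succ \<theta>} \<union> set ?gs)" "{b, x, succ \<theta>} \<union> set ?gs \<subseteq> constructible"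
      using gs x(1) Ord_constructible b(1) \<theta> by auto
    then obtain \<gamma> where \<gamma>: "Ord \<gamma>" "{b, x, succ \<theta>} \<union> set ?gs \<subseteq> elts (Lset \<gamma>)"
      by (rule constructible_cover_finite)
    have "R (Lset \<gamma>) \<xi>"
    proof -
      have "cert P n k b x \<xi> (succ \<theta>) ?gs" by (rule cert_graphs) (use \<theta> in auto)
      moreover have "\<exists>v\<in>elts b. (\<exists>l<k. length P \<le> l \<and> v = num l) \<and> opair \<theta> v \<in> elts (?gs ! 0)"
        using c(2) n num_in_b[of "fst (c \<theta>)"]
        by (intro bexI[of _ "num (fst (c \<theta>))"]) (auto simp: elts_graph k_def)
      moreover have "\<exists>v\<in>elts b. v = num 1 \<and> opair \<theta> v \<in> elts (?gs ! 1)"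
        using c(3) n code_in_b[of \<theta> 1]
        by (intro bexI[of _ "num 1"]) (auto simp: elts_graph)
      moreover have "length ?gs = n" "set ?gs \<subseteq> elts (Lset \<gamma>)" using \<gamma>(2) by auto
      ultimately have "\<exists>gs. length gs = n \<and> set gs \<subseteq> elts (Lset \<gamma>) \<and>
          (cert P n k b x \<xi> (succ \<theta>) gs \<and>
           (\<exists>v\<in>elts b. (\<exists>l<k. length P \<le> l \<and> v = num l) \<and> opair \<theta> v \<in> elts (gs ! 0)) \<and>
           (\<exists>v\<in>elts b. v = num 1 \<and> opair \<theta> v \<in> elts (gs ! 1)))"
        by blast
      moreover have "b \<in> elts (Lset \<gamma>)" "x \<in> elts (Lset \<gamma>)" "succ \<theta> \<in> elts (Lset \<gamma>)"
        using \<gamma>(2) by auto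
      moreover have "\<theta> \<in> elts (succ \<theta>)" by simp
      ultimately show ?thesis unfolding R_def by blast
    qed
    moreover have "\<xi> \<in> elts (Lset \<alpha>)" using \<alpha> \<xi> Ord_in_Lset_iff Ord_in_Ord by blast
    ultimately obtain w where w: "w \<in> elts (Lset \<alpha>)" "R w \<xi>"
      using Sigma1_reflection[OF elem _ D0] Lset_transitive[OF \<alpha>] Lset_constructible[OF \<gamma>(1)] by blast
    then obtain b' y' \<theta>' gs' l where
      b': "b' \<in> elts w" and y': "y' \<in> elts w" and cert': "cert P n k b' y' \<xi> (succ \<theta>') gs'"
      and line': "num l \<in> elts b'" "length P \<le> l" "opair \<theta>' (num l) \<in> elts (gs' ! 0)"
      and out': "num 1 \<in> elts b'" "opair \<theta>' (num 1) \<in> elts (gs' ! 1)"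
      unfolding R_def by blast
    obtain c' where c': "computation b' P y' [\<xi>] \<theta>' c'"
      "\<And>\<tau> i v. \<tau> \<in> elts (succ \<theta>') \<Longrightarrow> i < n \<Longrightarrow> v \<in> elts b' \<Longrightarrow>
         opair \<tau> v \<in> elts (gs' ! i) \<longleftrightarrow> v = code (c' \<tau>) i"
      using cert_sound[OF fits cert'] by blast
    have fin: "fst (c' \<theta>') = l" "snd (c' \<theta>') 0 = succ zero"
      using c'(2)[of \<theta>' 0 "num l"] c'(2)[of \<theta>' 1 "num 1"] line' out' n by auto
    have "Ord b'" using cert' by (simp add: cert_def)
    \<comment> \<open>The reflected bound is an ordinal in \<open>Lset \<alpha>\<close>, hence
      strictly below \<open>\<alpha>\<close>.\<close>
    then have b'\<alpha>: "b' \<in> elts \<alpha>" "elts b' \<subseteq> elts \<alpha>"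
      using Ord_in_Lset_iff[OF \<alpha>] Lset_transitive[OF \<alpha> b' w(1)] Ord_trans[OF \<alpha>] by blast+
    \<comment> \<open>An oracle agreeing with \<open>y'\<close> below \<open>b'\<close> is accepted
      by the same computation, so by recognition it is \<open>x\<close>.\<close>
    have accepted: "y = x"
      if y: "y \<in> constructible" "elts y \<subseteq> elts \<alpha>" "elts y' \<inter> elts b' = elts y \<inter> elts b'" for y
    proof -
      have "halts_with \<alpha> P y [\<xi>] (succ zero)"
        unfolding halts_with_def
        using computation_transfer[OF c'(1) b'\<alpha>(2) y(3)] fin line'(2) by blast
      then have "(if y = x then succ zero else zero) = (succ zero :: 'v)"
        by (rule halts_with_unique[OF rec[OF y(1,2)]])
      then show ?thesis by (simp split: if_splits)
    qed
    have wL: "w \<in> constructible" using constructibleI[OF \<alpha> w(1)] .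
    have L: "b' \<in> constructible" "y' \<in> constructible"
      using constructible_transitive[OF wL] b' y' by blast+
    \<comment> \<open>The sets \<open>y1\<close> and \<open>y2\<close> agree with \<open>y'\<close>
      below \<open>b'\<close> but differ at \<open>b'\<close> itself; since \<open>b'\<close> is
      below \<open>\<alpha>\<close>, both are subsets of \<open>\<alpha>\<close>.\<close>
    define y1 where "y1 = set_of (elts y' \<inter> elts b')"
    define y2 where "y2 = set_of (insert b' (elts y1))"
    have y1: "elts y1 = elts y' \<inter> elts b'"
      unfolding y1_def by (rule elts_set_of[of _ b']) blast
    have y2: "elts y2 = insert b' (elts y1)" unfolding y2_def by (rule elts_insert)
    have "y1 \<in> constructible" "y2 \<in> constructible"
      unfolding y2_def using Int_constructible[OF L(2,1)] insert_constructible L(1)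
      by (auto simp: y1_def)
    then have "y1 = x" "y2 = x"
      using b'\<alpha> mem_irrefl[of b'] by (intro accepted; auto simp: y1 y2)+
    then have "b' \<in> elts y1" using y2 by auto
    then show False using y1 mem_irrefl by blast
  qed
  then show ?thesis unfolding lost_melody_def by blast
qed

end
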